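(* Consider the bivariate current status model with hidden distribution function $F_0$ and observation distribution $G$ as described in the context. Consider an interior point $(t,u)$ of $[0,1]^2$, and define the square $A_n$, with midpoint $(t,u)$, by $$A_n=[t-h_n,t+h_n]\times[u-h_n,u+h_n],$$ where $h_n>0$. Suppose that the observation distribution $G$ is twice continuously differentiable at $(t,u)$ with a strictly positive density $g(t,u)$ at $(t,u)$, and that $F_0$ is twice continuously differentiable at $(t,u)$. Moreover, suppose $$\lim_{n\to\infty}h_n^2n^{1/3}=c>0.$$ Then the estimator $$\tilde F_n(t,u)=\frac{\int_{A_n}\delta_1\delta_2\,d\mathbb{P}_n(v,w,\delta_1,\delta_2)}{\int_{A_n}d\mathbb{G}_n(v,w)}$$ satisfies $$n^{1/3}\left\{\tilde F_n(t,u)-F_0(t,u)\right\}\stackrel{\mathcal{D}}{\longrightarrow}N(\beta,\sigma^2),$$ where $N(\beta,\sigma^2)$ is a normal distribution with first moment $$\beta=c\left\{\tfrac16\left\{\partial_1^2F_0(t,u)+\partial_2^2F_0(t,u)\right\}+\frac{\partial_1F_0(t,u)\,\partial_1g(t,u)+\partial_2F_0(t,u)\,\partial_2g(t,u)}{3g(t,u)}\right\}$$ and variance $$\sigma^2=\frac{F_0(t,u)\left\{1-F_0(t,u)\right\}}{4c\,g(t,u)}.$$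
   Context: Bivariate current status model: $(X_i,Y_i)$, $i=1,2,\dots$, are i.i.d. unobserved (hidden) random vectors with bivariate distribution function $F_0$, i.e. $F_0(x,y)=P(X_i\le x,\,Y_i\le y)$. The observation points $(T_i,U_i)$, $i=1,2,\dots$, are i.i.d. random vectors with bivariate distribution function $G$ (the observation distribution), and are independent of the $(X_i,Y_i)$. The distributions are taken to have support $[0,1]^2$. One observes the quadruples $(T_i,U_i,\Delta_{i1},\Delta_{i2})$, $i=1,\dots,n$, where $$\Delta_{i1}=1_{\{X_i\le T_i\}},\qquad \Delta_{i2}=1_{\{Y_i\le U_i\}}.$$ $\mathbb{P}_n$ denotes the empirical distribution function (empirical measure) of the observations $(T_i,U_i,\Delta_{i1},\Delta_{i2})$, $i=1,\dots,n$, and $\mathbb{G}_n$ that of the observations $(T_i,U_i)$, $i=1,\dots,n$. Thus $$\int_{A_n}\delta_1\delta_2\,d\mathbb{P}_n(v,w,\delta_1,\delta_2)=\frac1n\sum_{i=1}^n\Delta_{i1}\Delta_{i2}1_{A_n}(T_i,U_i),\qquad \int_{A_n}d\mathbb{G}_n(v,w)=\frac1n\sum_{i=1}^n1_{A_n}(T_i,U_i).$$ The function $g$ is the density of $G$. $\partial_j$ and $\partial_j^2$ denote the first and second order partial derivatives with respect to the $j$th coordinate, $j=1,2$. $\stackrel{\mathcal{D}}{\longrightarrow}$ denotes convergence in distribution as $n\to\infty$.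
   Formalization: The density g is additionally assumed (totally) differentiable at (t,u); twice continuous differentiability of G does not ensure that the partials of g in β exist, and their mere existence is not enough for the stated bias. *)

theory Defs
  imports "HOL-Probability.Probability"
begin

definition partial1 :: "(real \<times> real \<Rightarrow> real) \<Rightarrow> real \<times> real \<Rightarrow> real" where
  "partial1 f p = deriv (\<lambda>x. f (x, snd p)) (fst p)"

definition partial2 :: "(real \<times> real \<Rightarrow> real) \<Rightarrow> real \<times> real \<Rightarrow> real" where
  "partial2 f p = deriv (\<lambda>y. f (fst p, y)) (snd p)"

definition has_partials_at :: "(real \<times> real \<Rightarrow> real) \<Rightarrow> real \<times> real \<Rightarrow> bool" where
  "has_partials_at f p \<longleftrightarrow>
     (\<lambda>x. f (x, snd p)) field_differentiable at (fst p) \<and>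
     (\<lambda>y. f (fst p, y)) field_differentiable at (snd p)"

text \<open>Being twice continuously differentiable \<^emph>\<open>at a point\<close>: all partial derivatives of order at
  most two exist in a neighbourhood of the point and are continuous at the point.\<close>

definition twice_cont_diff_at :: "(real \<times> real \<Rightarrow> real) \<Rightarrow> real \<times> real \<Rightarrow> bool" where
  "twice_cont_diff_at f p \<longleftrightarrow>
     (\<exists>S. open S \<and> p \<in> S \<and>
        (\<forall>q\<in>S. has_partials_at f q \<and> has_partials_at (partial1 f) q \<and> has_partials_at (partial2 f) q)) \<and>
     isCont f p \<and> isCont (partial1 f) p \<and> isCont (partial2 f) p \<and>
     isCont (partial1 (partial1 f)) p \<and> isCont (partial2 (partial1 f)) p \<and>
     isCont (partial1 (partial2 f)) p \<and> isCont (partial2 (partial2 f)) p"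

definition topological_support :: "('a::topological_space) measure \<Rightarrow> 'a set" where
  "topological_support \<mu> = {x. \<forall>S. open S \<longrightarrow> x \<in> S \<longrightarrow> 0 < emeasure \<mu> S}"

text \<open>The hidden vectors are \<open>(X i, Y i)\<close> with distribution function \<open>F0\<close>; the observation points
  are \<open>(T i, U i)\<close> with distribution function \<open>G\<close> and Lebesgue density \<open>g\<close>. Samples are indexed
  from 0. The last independence assumption is between the two sequences as a whole.\<close>

locale bivariate_current_status = prob_space M
  for M :: "'a measure" +
  fixes X Y T U :: "nat \<Rightarrow> 'a \<Rightarrow> real"
    and F0 G g :: "real \<times> real \<Rightarrow> real"
  assumes indep_hidden: "indep_vars (\<lambda>_. borel) (\<lambda>i \<omega>. (X i \<omega>, Y i \<omega>)) UNIV"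
    and indep_observation: "indep_vars (\<lambda>_. borel) (\<lambda>i \<omega>. (T i \<omega>, U i \<omega>)) UNIV"
    and indep_hidden_observation:
      "indep_var (PiM UNIV (\<lambda>_. borel)) (\<lambda>\<omega> i. (X i \<omega>, Y i \<omega>))
                 (PiM UNIV (\<lambda>_. borel)) (\<lambda>\<omega> i. (T i \<omega>, U i \<omega>))"
    and hidden_cdf: "\<And>i x y. F0 (x, y) = \<P>(\<omega> in M. X i \<omega> \<le> x \<and> Y i \<omega> \<le> y)"
    and observation_cdf: "\<And>i x y. G (x, y) = \<P>(\<omega> in M. T i \<omega> \<le> x \<and> U i \<omega> \<le> y)"
    and density_nonneg: "\<And>z. 0 \<le> g z"
    and observation_density: "\<And>i. distributed M lborel (\<lambda>\<omega>. (T i \<omega>, U i \<omega>)) (\<lambda>z. ennreal (g z))"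
    and hidden_support:
      "\<And>i. topological_support (distr M borel (\<lambda>\<omega>. (X i \<omega>, Y i \<omega>))) = {0..1} \<times> {0..1}"
    and observation_support:
      "\<And>i. topological_support (distr M borel (\<lambda>\<omega>. (T i \<omega>, U i \<omega>))) = {0..1} \<times> {0..1}"

definition empirical_measure :: "nat \<Rightarrow> (nat \<Rightarrow> 'b::topological_space) \<Rightarrow> 'b measure" where
  "empirical_measure n z = distr (uniform_count_measure {..<n}) borel z"

definition square :: "real \<times> real \<Rightarrow> real \<Rightarrow> (real \<times> real) set" where
  "square p r = {fst p - r..fst p + r} \<times> {snd p - r..snd p + r}"

context
  fixes X Y T U :: "nat \<Rightarrow> 'a \<Rightarrow> real"
begin

definition observed :: "'a \<Rightarrow> nat \<Rightarrow> real \<times> real \<times> real \<times> real" where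
  "observed \<omega> i = (T i \<omega>, U i \<omega>, of_bool (X i \<omega> \<le> T i \<omega>), of_bool (Y i \<omega> \<le> U i \<omega>))"

text \<open>If no observation point falls into \<open>A\<close>, the quotient below is \<open>0 / 0\<close>, hence 0.\<close>

definition local_estimator :: "nat \<Rightarrow> (real \<times> real) set \<Rightarrow> 'a \<Rightarrow> real" where
  "local_estimator n A \<omega> =
     (LINT z:{(v, w, d1, d2). (v, w) \<in> A}|empirical_measure n (observed \<omega>).
        (case z of (v, w, d1, d2) \<Rightarrow> d1 * d2)) /
     (LINT z:A|empirical_measure n (\<lambda>i. (T i \<omega>, U i \<omega>)). 1)"

end

lemma set_integral_empirical_measure:
  fixes f :: "'b::topological_space \<Rightarrow> real"
  assumes "n > 0" and A: "A \<in> sets borel" and f: "f \<in> borel_measurable borel"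
  shows "(LINT z:A|empirical_measure n x. f z) = (\<Sum>i<n. indicator A (x i) * f (x i)) / n"
proof -
  have "x \<in> measurable (uniform_count_measure {..<n}) borel"
    by (simp add: measurable_def space_uniform_count_measure sets_uniform_count_measure)
  then have "(LINT z:A|empirical_measure n x. f z)
      = (LINT i|uniform_count_measure {..<n}. indicator A (x i) * f (x i))"
    using A f unfolding set_lebesgue_integral_def empirical_measure_def
    by (subst integral_distr) auto
  then show ?thesis
    by (simp add: integral_uniform_count_measure)
qed

lemma local_estimator_eq:
  assumes "n > 0" and A: "A \<in> sets borel"
  shows "local_estimator X Y T U n A \<omega> =
    ((\<Sum>i<n. of_bool (X i \<omega> \<le> T i \<omega>) * of_bool (Y i \<omega> \<le> U i \<omega>) * indicator A (T i \<omega>, U i \<omega>)) / n) /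
    ((\<Sum>i<n. indicator A (T i \<omega>, U i \<omega>)) / n)"
proof -
  have "(\<lambda>(v, w, d1, d2). (v, w)) \<in> borel_measurable (borel :: (real \<times> real \<times> real \<times> real) measure)"
    by (intro borel_measurable_continuous_onI) (auto simp: case_prod_unfold intro!: continuous_intros)
  then have "(\<lambda>(v, w, d1, d2). (v, w)) -` A \<inter> space borel
      \<in> sets (borel :: (real \<times> real \<times> real \<times> real) measure)"
    using A by (rule measurable_sets)
  moreover have "(\<lambda>(v, w, d1, d2). (v, w)) -` A \<inter> space borel
      = {(v::real, w::real, d1::real, d2::real). (v, w) \<in> A}"
    by auto
  ultimately have *: "{(v::real, w::real, d1::real, d2::real). (v, w) \<in> A} \<in> sets borel"
    by simp
  have **: "(\<lambda>z::real \<times> real \<times> real \<times> real. case z of (v, w, d1, d2) \<Rightarrow> d1 * d2)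
      \<in> borel_measurable borel"
    by (intro borel_measurable_continuous_onI) (auto simp: case_prod_unfold intro!: continuous_intros)
  show ?thesis
    unfolding local_estimator_def
      set_integral_empirical_measure[OF \<open>n > 0\<close> * **]
      set_integral_empirical_measure[OF \<open>n > 0\<close> A borel_measurable_const]
    by (simp add: observed_def indicator_def mult_ac)
qed

end

theory Submission
  imports Defs
begin

text \<open>No separate treatment of the random denominator is needed. The event that the normalised error is
  at most \<open>x\<close> says that the numerator count is at most \<open>F\<^sub>0(t,u) + x n\<^sup>-\<^sup>1\<^sup>/\<^sup>3\<close> times the denominator count,
  that is, that a sum of \<open>n\<close> independent bounded variables is nonpositive. This sum converges weakly to
  \<open>N(\<beta> - x, \<sigma>\<^sup>2)\<close> by a central limit theorem for triangular arrays, proved with characteristic functions.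
  Its moments are integrals of \<open>g\<close> and \<open>F\<^sub>0 g\<close> over the square; the bias comes from the second order
  expansion of \<open>(F\<^sub>0 - F\<^sub>0(t,u)) g\<close>, of which only the pure squares survive integration.\<close>

subsection \<open>Taylor expansions at a point\<close>

text \<open>The rate balances two errors. The square has area \<open>4 * (h n)\<^sup>2\<close> and
  catches about \<open>4 * n * (h n)\<^sup>2 * g (t, u)\<close> observation points, of order
  \<open>n powr (2/3)\<close>, so the random error of the quotient is of order
  \<open>n powr (-1/3)\<close>. The smoothing bias is of order \<open>(h n)\<^sup>2\<close>, which
  is \<open>n powr (-1/3)\<close> again; hence both a mean and a variance survive in the limit. Two
  obstacles shape the proof. Second derivatives of \<open>F0\<close> are continuous only at the
  point itself and \<open>g\<close> is only differentiable there, so every expansion is a little-o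
  statement at \<open>nhds p\<close>, and its remainder is integrated by comparison with the area of
  the square. Moreover an empty square makes the quotient 0 / 0, and then the event about the
  quotient need not be the event that the sum is nonpositive. The discrepancy sits where the sum is
  exactly 0, and continuity of the normal distribution function absorbs it.\<close>

lemma has_partials_at_partial1:
  assumes "has_partials_at f q"
  shows "((\<lambda>x. f (x, snd q)) has_real_derivative partial1 f q) (at (fst q))"
  using assms unfolding has_partials_at_def partial1_def
  by (simp add: DERIV_deriv_iff_field_differentiable)

lemma has_partials_at_partial2:
  assumes "has_partials_at f q"
  shows "((\<lambda>y. f (fst q, y)) has_real_derivative partial2 f q) (at (snd q))"
  using assms unfolding has_partials_at_def partial2_def
  by (simp add: DERIV_deriv_iff_field_differentiable)

text \<open>Formulated on \<open>closed_segment\<close> so that \<open>x\<close> may lie on either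
  side of \<open>c\<close> or coincide with it; in the last case \<xi> = c serves.\<close>

lemma Taylor_order_two:
  fixes f f' f'' :: "real \<Rightarrow> real"
  assumes 1: "\<And>s. s \<in> closed_segment c x \<Longrightarrow> (f has_real_derivative f' s) (at s)"
    and 2: "\<And>s. s \<in> closed_segment c x \<Longrightarrow> (f' has_real_derivative f'' s) (at s)"
  obtains \<xi> where "\<xi> \<in> closed_segment c x" "f x = f c + f' c * (x - c) + f'' \<xi> / 2 * (x - c)\<^sup>2"
proof (cases "x = c")
  case True
  then show ?thesis using that[of c] by simp
next
  case False
  define d where "d m = (if m = (0::nat) then f else if m = 1 then f' else f'')" for m
  have "\<exists>\<xi>. (if x < c then x < \<xi> \<and> \<xi> < c else c < \<xi> \<and> \<xi> < x) \<and>
      f x = (\<Sum>m<2. d m c / fact m * (x - c)^m) + d 2 \<xi> / fact 2 * (x - c)^2"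
    using False
    by (intro Taylor[of 2 d f "min c x" "max c x"])
       (auto simp: d_def less_2_cases_iff closed_segment_eq_real_ivl intro!: 1 2)
  then obtain \<xi> where "if x < c then x < \<xi> \<and> \<xi> < c else c < \<xi> \<and> \<xi> < x"
      "f x = (\<Sum>m<2. d m c / fact m * (x - c)^m) + d 2 \<xi> / fact 2 * (x - c)^2"
    by blast
  then show ?thesis
    by (intro that[of \<xi>]) (auto simp: d_def closed_segment_eq_real_ivl eval_nat_numeral split: if_splits)
qed

lemma mean_value_segment:
  fixes f f' :: "real \<Rightarrow> real"
  assumes "\<And>s. s \<in> closed_segment c x \<Longrightarrow> (f has_real_derivative f' s) (at s)"
  obtains \<xi> where "\<xi> \<in> closed_segment c x" "f x = f c + f' \<xi> * (x - c)"
proof -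
  consider "x = c" | "c < x" | "x < c" by linarith
  then show ?thesis
  proof cases
    case 1 then show ?thesis using that[of c] by simp
  next
    case 2
    then obtain z where "c < z" "z < x" "f x - f c = (x - c) * f' z"
      using MVT2[of c x f f'] assms by (auto simp: closed_segment_eq_real_ivl)
    then show ?thesis using 2 by (intro that[of z]) (auto simp: closed_segment_eq_real_ivl algebra_simps)
  next
    case 3
    then obtain z where "x < z" "z < c" "f c - f x = (c - x) * f' z"
      using MVT2[of x c f f'] assms by (auto simp: closed_segment_eq_real_ivl)
    then show ?thesis using 3 by (intro that[of z]) (auto simp: closed_segment_eq_real_ivl algebra_simps)
  qed
qed

text \<open>The increment from (t, u) to (x, y) is taken through the corner (t, y): a second order
  expansion along the horizontal side, one along the vertical side, and the mean value theorem to
  move \<open>partial1 f\<close> from (t, y) to (t, u). The last move produces the mixed term.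
  Continuity of the second derivatives at \<open>p\<close> replaces their values at the intermediate
  points by those at \<open>p\<close>.\<close>

lemma twice_cont_diff_at_Taylor:
  assumes "twice_cont_diff_at f p"
  shows "(\<lambda>z. f z - f p - (partial1 f p * (fst z - fst p) + partial2 f p * (snd z - snd p)
            + (partial1 (partial1 f) p / 2 * (fst z - fst p)\<^sup>2
              + partial2 (partial1 f) p * ((fst z - fst p) * (snd z - snd p))
              + partial2 (partial2 f) p / 2 * (snd z - snd p)\<^sup>2)))
         \<in> o[nhds p](\<lambda>z. norm (z - p) ^ 2)"
proof (rule landau_o.smallI)
  fix \<epsilon> :: real assume \<epsilon>: "\<epsilon> > 0"
  obtain S where S: "open S" "p \<in> S"
    and part: "\<And>q. q \<in> S \<Longrightarrow> has_partials_at f q"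
      "\<And>q. q \<in> S \<Longrightarrow> has_partials_at (partial1 f) q"
      "\<And>q. q \<in> S \<Longrightarrow> has_partials_at (partial2 f) q"
    using assms unfolding twice_cont_diff_at_def by blast
  have near: "eventually (\<lambda>q. dist (k q) (k p) < \<epsilon>) (nhds p)" if "isCont k p" for k :: "real \<times> real \<Rightarrow> real"
    using that \<epsilon> by (intro tendstoD) (auto simp: continuous_at tendsto_at_iff_tendsto_nhds)
  have "eventually (\<lambda>q. q \<in> S \<and> dist (partial1 (partial1 f) q) (partial1 (partial1 f) p) < \<epsilon> \<and>
      dist (partial2 (partial1 f) q) (partial2 (partial1 f) p) < \<epsilon> \<and>
      dist (partial2 (partial2 f) q) (partial2 (partial2 f) p) < \<epsilon>) (nhds p)"
    using assms S unfolding twice_cont_diff_at_def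
    by (intro eventually_conj near eventually_nhds_in_open) auto
  then obtain r where r: "r > 0" and
      "\<And>q. dist q p < r \<Longrightarrow> q \<in> S \<and> dist (partial1 (partial1 f) q) (partial1 (partial1 f) p) < \<epsilon> \<and>
      dist (partial2 (partial1 f) q) (partial2 (partial1 f) p) < \<epsilon> \<and>
      dist (partial2 (partial2 f) q) (partial2 (partial2 f) p) < \<epsilon>"
    unfolding eventually_nhds_metric by blast
  then have inS: "q \<in> S" and bd: "\<bar>partial1 (partial1 f) q - partial1 (partial1 f) p\<bar> < \<epsilon>"
      "\<bar>partial2 (partial1 f) q - partial2 (partial1 f) p\<bar> < \<epsilon>"
      "\<bar>partial2 (partial2 f) q - partial2 (partial2 f) p\<bar> < \<epsilon>" if "dist q p < r" for q
    using that by (auto simp: dist_real_def)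
  obtain t u where p: "p = (t, u)" by fastforce
  have *: "\<bar>f (x, y) - f p - (partial1 f p * (x - t) + partial2 f p * (y - u)
            + (partial1 (partial1 f) p / 2 * (x - t)\<^sup>2
              + partial2 (partial1 f) p * ((x - t) * (y - u))
              + partial2 (partial2 f) p / 2 * (y - u)\<^sup>2))\<bar> \<le> \<epsilon> * ((x - t)\<^sup>2 + (y - u)\<^sup>2)"
    if xy: "dist (x, y) p < r" for x y
  proof -
    \<comment> \<open>All intermediate points lie in the rectangle with opposite corners
      \<open>p\<close> and (x, y), hence no farther from \<open>p\<close> than (x, y): one radius
      \<open>r\<close> controls them all.\<close>
    have box: "dist (x', y') p < r" if "x' \<in> closed_segment t x" "y' \<in> closed_segment u y" for x' y'
    proof -
      have "\<bar>x' - t\<bar> \<le> \<bar>x - t\<bar>" "\<bar>y' - u\<bar> \<le> \<bar>y - u\<bar>"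
        using that by (auto simp: closed_segment_eq_real_ivl split: if_splits)
      then have "dist (x', y') p \<le> dist (x, y) p"
        by (auto simp: p dist_Pair_Pair dist_real_def power2_le_iff_abs_le abs_le_square_iff[symmetric] intro!: add_mono)
      with xy show ?thesis by simp
    qed
    note D1 = has_partials_at_partial1[OF part(1)[OF inS[OF box]], simplified]
    note D2 = has_partials_at_partial2[OF part(1)[OF inS[OF box]], simplified]
    note D11 = has_partials_at_partial1[OF part(2)[OF inS[OF box]], simplified]
    note D21 = has_partials_at_partial2[OF part(2)[OF inS[OF box]], simplified]
    note D22 = has_partials_at_partial2[OF part(3)[OF inS[OF box]], simplified]
    obtain \<xi> where \<xi>: "\<xi> \<in> closed_segment t x" "f (x, y) = f (t, y) + partial1 f (t, y) * (x - t)
        + partial1 (partial1 f) (\<xi>, y) / 2 * (x - t)\<^sup>2"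
      by (rule Taylor_order_two[of t x "\<lambda>x. f (x, y)" "\<lambda>x. partial1 f (x, y)"
            "\<lambda>x. partial1 (partial1 f) (x, y)"]) (auto intro!: D1 D11)
    obtain \<eta> where \<eta>: "\<eta> \<in> closed_segment u y" "f (t, y) = f (t, u) + partial2 f (t, u) * (y - u)
        + partial2 (partial2 f) (t, \<eta>) / 2 * (y - u)\<^sup>2"
      by (rule Taylor_order_two[of u y "\<lambda>y. f (t, y)" "\<lambda>y. partial2 f (t, y)"
            "\<lambda>y. partial2 (partial2 f) (t, y)"]) (auto intro!: D2 D22)
    obtain \<theta> where \<theta>: "\<theta> \<in> closed_segment u y"
        "partial1 f (t, y) = partial1 f (t, u) + partial2 (partial1 f) (t, \<theta>) * (y - u)"
      by (rule mean_value_segment[of u y "\<lambda>y. partial1 f (t, y)" "\<lambda>y. partial2 (partial1 f) (t, y)"])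
         (auto intro!: D21)
    \<comment> \<open>\<open>A\<close>, \<open>B\<close>, \<open>C\<close> are the oscillations of
      the second derivatives between the intermediate points and \<open>p\<close>; they are all that
      remains of the remainder.\<close>
    define A where "A = partial1 (partial1 f) (\<xi>, y) - partial1 (partial1 f) p"
    define B where "B = partial2 (partial1 f) (t, \<theta>) - partial2 (partial1 f) p"
    define C where "C = partial2 (partial2 f) (t, \<eta>) - partial2 (partial2 f) p"
    have ABC: "\<bar>A\<bar> \<le> \<epsilon>" "\<bar>B\<bar> \<le> \<epsilon>" "\<bar>C\<bar> \<le> \<epsilon>"
      using bd(1)[OF box, of \<xi> y] bd(2)[OF box, of t \<theta>] bd(3)[OF box, of t \<eta>] \<xi>(1) \<eta>(1) \<theta>(1)
      by (auto simp: A_def B_def C_def)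
    have "f (x, y) - f p - (partial1 f p * (x - t) + partial2 f p * (y - u)
            + (partial1 (partial1 f) p / 2 * (x - t)\<^sup>2
              + partial2 (partial1 f) p * ((x - t) * (y - u))
              + partial2 (partial2 f) p / 2 * (y - u)\<^sup>2))
      = A / 2 * (x - t)\<^sup>2 + B * ((x - t) * (y - u)) + C / 2 * (y - u)\<^sup>2"
      using \<xi>(2) \<eta>(2) \<theta>(2) by (simp add: A_def B_def C_def p field_simps)
    also have "\<bar>\<dots>\<bar> \<le> \<bar>A / 2 * (x - t)\<^sup>2\<bar> + \<bar>B * ((x - t) * (y - u))\<bar> + \<bar>C / 2 * (y - u)\<^sup>2\<bar>"
      by linarith
    also have "\<dots> = \<bar>A\<bar> * ((x - t)\<^sup>2 / 2) + \<bar>B\<bar> * (\<bar>x - t\<bar> * \<bar>y - u\<bar>) + \<bar>C\<bar> * ((y - u)\<^sup>2 / 2)"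
      by (simp add: abs_mult)
    also have "\<dots> \<le> \<epsilon> * ((x - t)\<^sup>2 / 2) + \<epsilon> * (\<bar>x - t\<bar> * \<bar>y - u\<bar>) + \<epsilon> * ((y - u)\<^sup>2 / 2)"
      using ABC by (intro add_mono mult_right_mono) auto
    also have "\<dots> = \<epsilon> * ((\<bar>x - t\<bar> + \<bar>y - u\<bar>)\<^sup>2 / 2)"
      by (simp add: power2_sum field_simps)
    also have "\<dots> \<le> \<epsilon> * ((x - t)\<^sup>2 + (y - u)\<^sup>2)"
      using \<epsilon> sum_squares_bound[of "\<bar>x - t\<bar>" "\<bar>y - u\<bar>"]
      by (intro mult_left_mono) (auto simp: power2_sum)
    finally show ?thesis .
  qed
  show "eventually (\<lambda>z. norm (f z - f p - (partial1 f p * (fst z - fst p) + partial2 f p * (snd z - snd p)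
            + (partial1 (partial1 f) p / 2 * (fst z - fst p)\<^sup>2
              + partial2 (partial1 f) p * ((fst z - fst p) * (snd z - snd p))
              + partial2 (partial2 f) p / 2 * (snd z - snd p)\<^sup>2)))
            \<le> \<epsilon> * norm (norm (z - p) ^ 2)) (nhds p)"
    unfolding eventually_nhds_metric
  proof (intro exI[of _ r] conjI allI impI)
    fix z assume "dist z p < r"
    then show "norm (f z - f p - (partial1 f p * (fst z - fst p) + partial2 f p * (snd z - snd p)
            + (partial1 (partial1 f) p / 2 * (fst z - fst p)\<^sup>2
              + partial2 (partial1 f) p * ((fst z - fst p) * (snd z - snd p))
              + partial2 (partial2 f) p / 2 * (snd z - snd p)\<^sup>2)))
            \<le> \<epsilon> * norm (norm (z - p) ^ 2)"
      using *[of "fst z" "snd z"] by (simp add: p norm_prod_def)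
  qed (rule r)
qed

text \<open>Restricting \<open>f\<close> to the two coordinate lines through \<open>p\<close>
  identifies the values of the Frechet derivative on the unit vectors with
  \<open>partial1 f p\<close> and \<open>partial2 f p\<close>; the rest is the definition of the
  derivative.\<close>

lemma differentiable_expansion:
  fixes f :: "real \<times> real \<Rightarrow> real"
  assumes "f differentiable at p"
  shows "(\<lambda>z. f z - f p - (partial1 f p * (fst z - fst p) + partial2 f p * (snd z - snd p)))
    \<in> o[nhds p](\<lambda>z. norm (z - p))"
proof -
  obtain D where D: "(f has_derivative D) (at p)"
    using assms by (auto simp: differentiable_def)
  then interpret D: bounded_linear D by (rule has_derivative_bounded_linear)
  have d1: "((\<lambda>x. f (x, snd p)) has_derivative (\<lambda>a. D (a, 0))) (at (fst p))"
    using has_derivative_compose[OF has_derivative_Pair[OF has_derivative_ident has_derivative_const], of f D "fst p" "snd p" UNIV] D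
    by simp
  have D1: "D (a, 0) = D (1, 0) * a" for a
    using D.scaleR[of a "(1, 0)"] by (simp add: mult.commute)
  have "((\<lambda>x. f (x, snd p)) has_real_derivative D (1, 0)) (at (fst p))"
    unfolding has_field_derivative_def by (rule has_derivative_eq_rhs[OF d1 ext[OF D1]])
  then have 1: "partial1 f p = D (1, 0)"
    unfolding partial1_def by (rule DERIV_imp_deriv)
  have d2: "((\<lambda>y. f (fst p, y)) has_derivative (\<lambda>b. D (0, b))) (at (snd p))"
    using has_derivative_compose[OF has_derivative_Pair[OF has_derivative_const has_derivative_ident], of f D "fst p" "snd p" UNIV] D
    by simp
  have D2: "D (0, b) = D (0, 1) * b" for b
    using D.scaleR[of b "(0, 1)"] by (simp add: mult.commute)
  have "((\<lambda>y. f (fst p, y)) has_real_derivative D (0, 1)) (at (snd p))"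
    unfolding has_field_derivative_def by (rule has_derivative_eq_rhs[OF d2 ext[OF D2]])
  then have 2: "partial2 f p = D (0, 1)"
    unfolding partial2_def by (rule DERIV_imp_deriv)
  have lin: "D z = partial1 f p * fst z + partial2 f p * snd z" for z
    using D.add[of "(fst z, 0)" "(0, snd z)"] unfolding 1 2 D1[of "fst z"] D2[of "snd z"] by simp
  show ?thesis
  proof (rule landau_o.smallI)
    fix \<epsilon> :: real assume "\<epsilon> > 0"
    then obtain d where "d > 0" "\<And>z. norm (z - p) < d \<Longrightarrow> norm (f z - f p - D (z - p)) \<le> \<epsilon> * norm (z - p)"
      using D unfolding has_derivative_at_alt by blast
    then show "eventually (\<lambda>z. norm (f z - f p - (partial1 f p * (fst z - fst p) + partial2 f p * (snd z - snd p)))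
        \<le> \<epsilon> * norm (norm (z - p))) (nhds p)"
      by (auto simp: eventually_nhds_metric dist_norm lin)
  qed
qed

lemma fst_diff_bigo: "(\<lambda>z. fst z - fst p) \<in> O[nhds p](\<lambda>z. norm (z - p))"
  and snd_diff_bigo: "(\<lambda>z. snd z - snd p) \<in> O[nhds p](\<lambda>z. norm (z - p))"
  for p :: "real \<times> real"
proof -
  have "\<bar>fst z - fst p\<bar> \<le> norm (z - p)" "\<bar>snd z - snd p\<bar> \<le> norm (z - p)" for z
    using norm_fst_le[of "fst (z - p)" "snd (z - p)"] norm_snd_le[of "snd (z - p)" "fst (z - p)"]
    by (simp_all add: minus_prod_def)
  then show "(\<lambda>z. fst z - fst p) \<in> O[nhds p](\<lambda>z. norm (z - p))"
    "(\<lambda>z. snd z - snd p) \<in> O[nhds p](\<lambda>z. norm (z - p))"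
    by (auto intro!: bigoI[where c = 1] always_eventually)
qed

text \<open>The increment of \<open>F\<close> has no constant term, so a first order expansion of
  \<open>g\<close> already gives second order accuracy of the product. The products of the two
  linear parts supply the gradient terms of \<beta>.\<close>

lemma expansion_weighted_increment:
  fixes F g :: "real \<times> real \<Rightarrow> real"
  assumes F: "twice_cont_diff_at F p" and g: "g differentiable at p"
  shows "(\<lambda>z. (F z - F p) * g z
      - (g p * partial1 F p * (fst z - fst p) + g p * partial2 F p * (snd z - snd p)
        + ((g p * (partial1 (partial1 F) p / 2) + partial1 F p * partial1 g p) * (fst z - fst p)\<^sup>2
          + (g p * partial2 (partial1 F) p + partial1 F p * partial2 g p + partial2 F p * partial1 g p)
            * ((fst z - fst p) * (snd z - snd p))
          + (g p * (partial2 (partial2 F) p / 2) + partial2 F p * partial2 g p) * (snd z - snd p)\<^sup>2)))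
    \<in> o[nhds p](\<lambda>z. norm (z - p) ^ 2)"
proof -
  define N where "N z = norm (z - p)" for z
  define L where "L z = partial1 F p * (fst z - fst p) + partial2 F p * (snd z - snd p)" for z
  define Q where "Q z = partial1 (partial1 F) p / 2 * (fst z - fst p)\<^sup>2
              + partial2 (partial1 F) p * ((fst z - fst p) * (snd z - snd p))
              + partial2 (partial2 F) p / 2 * (snd z - snd p)\<^sup>2" for z
  define R where "R z = F z - F p - (L z + Q z)" for z
  define S where "S z = g z - g p - (partial1 g p * (fst z - fst p) + partial2 g p * (snd z - snd p))" for z
  have R: "R \<in> o[nhds p](\<lambda>z. N z ^ 2)"
    using twice_cont_diff_at_Taylor[OF F] by (simp add: R_def[abs_def] L_def Q_def N_def[abs_def])
  have S: "S \<in> o[nhds p](N)"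
    using differentiable_expansion[OF g] by (simp add: S_def[abs_def] N_def[abs_def])
  have fst: "(\<lambda>z. fst z - fst p) \<in> O[nhds p](N)" and snd: "(\<lambda>z. snd z - snd p) \<in> O[nhds p](N)"
    using fst_diff_bigo[of p] snd_diff_bigo[of p] by (simp_all add: N_def[abs_def])
  have L: "L \<in> O[nhds p](N)"
    unfolding L_def[abs_def] using fst snd by (auto intro!: sum_in_bigo)
  have Q: "Q \<in> O[nhds p](\<lambda>z. N z ^ 2)"
  proof -
    have scale: "(\<lambda>z. c * k z) \<in> O[nhds p](l)" if "k \<in> O[nhds p](l)" for c and k l :: "real \<times> real \<Rightarrow> real"
      using that by (cases "c = 0") auto
    show ?thesis
      unfolding Q_def[abs_def] power2_eq_square
      by (intro sum_in_bigo scale landau_o.big.mult fst snd)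
  qed
  have "isCont g p"
    using g by (rule differentiable_imp_continuous_within)
  then have lim: "(g \<longlongrightarrow> g p) (nhds p)"
    by (simp add: continuous_at tendsto_at_iff_tendsto_nhds)
  then have g1: "g \<in> O[nhds p](\<lambda>_. 1)"
    by (intro bigoI_tendsto[where c = "g p"]) auto
  have "((\<lambda>z. g z - g p) \<longlongrightarrow> 0) (nhds p)"
    using lim by (rule LIM_zero)
  then have g0: "(\<lambda>z. g z - g p) \<in> o[nhds p](\<lambda>_. 1)"
    by (intro smalloI_tendsto) auto
  have "(\<lambda>z. L z * S z) \<in> o[nhds p](\<lambda>z. N z * N z)"
    using L S by (rule landau_o.big_small_mult)
  moreover have "(\<lambda>z. Q z * (g z - g p)) \<in> o[nhds p](\<lambda>z. N z ^ 2 * 1)"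
    using Q g0 by (rule landau_o.big_small_mult)
  moreover have "(\<lambda>z. R z * g z) \<in> o[nhds p](\<lambda>z. N z ^ 2 * 1)"
    using R g1 by (rule landau_o.small_big_mult)
  ultimately have "(\<lambda>z. L z * S z + Q z * (g z - g p) + R z * g z) \<in> o[nhds p](\<lambda>z. N z ^ 2)"
    by (intro sum_in_smallo) (simp_all add: power2_eq_square)
  \<comment> \<open>The increment of \<open>F\<close> is \<open>L + Q + R\<close>. Expanding
    \<open>g\<close> to first order against \<open>L\<close>, replacing it by \<open>g p\<close>
    against \<open>Q\<close> and keeping it against \<open>R\<close> leaves exactly this
    error.\<close>
  also have "(\<lambda>z. L z * S z + Q z * (g z - g p) + R z * g z) = (\<lambda>z. (F z - F p) * g z
      - (g p * partial1 F p * (fst z - fst p) + g p * partial2 F p * (snd z - snd p)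
        + ((g p * (partial1 (partial1 F) p / 2) + partial1 F p * partial1 g p) * (fst z - fst p)\<^sup>2
          + (g p * partial2 (partial1 F) p + partial1 F p * partial2 g p + partial2 F p * partial1 g p)
            * ((fst z - fst p) * (snd z - snd p))
          + (g p * (partial2 (partial2 F) p / 2) + partial2 F p * partial2 g p) * (snd z - snd p)\<^sup>2)))" (is "?lhs = ?rhs")
  proof
    fix z
    \<comment> \<open>Naming the halved second derivatives turns the claim into a polynomial
      identity for \<open>algebra\<close>.\<close>
    define k\<^sub>1 k\<^sub>2 where k: "k\<^sub>1 = partial1 (partial1 F) p / 2" "k\<^sub>2 = partial2 (partial2 F) p / 2"
    show "?lhs z = ?rhs z"
      unfolding R_def S_def Q_def L_def k[symmetric] power2_eq_square by algebra
  qed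
  finally show ?thesis by (simp add: N_def[abs_def])
qed

subsection \<open>Integrals over small squares\<close>

lemma compact_square: "compact (square p r)"
  unfolding square_def by (intro compact_Times) auto

lemma square_in_borel [measurable]: "square p r \<in> sets borel"
  by (intro borel_compact compact_square)

lemma set_integrable_square:
  assumes "continuous_on UNIV f"
  shows "set_integrable lborel (square p r) (f :: real \<times> real \<Rightarrow> real)"
  unfolding set_integrable_def
  by (intro borel_integrable_compact compact_square continuous_on_subset[OF assms]) auto

text \<open>Fubini splits the integral into two one-dimensional ones. The form
  \<open>r ^ Suc j - (- r) ^ Suc j\<close> treats both parities at once: it is 0 for odd
  \<open>j\<close> and \<open>2 * r ^ Suc j\<close> for even \<open>j\<close>.\<close>

lemma set_integral_square_monomial:
  assumes "r \<ge> 0"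
  shows "(LINT z:square p r|lborel. (fst z - fst p) ^ j * (snd z - snd p) ^ k)
    = ((r ^ Suc j - (- r) ^ Suc j) / Suc j) * ((r ^ Suc k - (- r) ^ Suc k) / Suc k)"
proof -
  have one: "(\<integral>x. (x - a) ^ m * indicator {a - r..a + r} x \<partial>lborel) = (r ^ Suc m - (- r) ^ Suc m) / Suc m"
    for a :: real and m
  proof (subst integral_FTC_Icc_real)
    show "((\<lambda>x. (x - a) ^ Suc m / Suc m) has_real_derivative (x - a) ^ m) (at x)" for x
      by (intro derivative_eq_intros) auto
  qed (use assms in \<open>auto simp: diff_divide_distrib simp del: power_Suc\<close>)
  let ?f = "\<lambda>z. indicator (square p r) z *\<^sub>R ((fst z - fst p) ^ j * (snd z - snd p) ^ k)"
  have "set_integrable lborel (square p r) (\<lambda>z. (fst z - fst p) ^ j * (snd z - snd p) ^ k)"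
    by (intro set_integrable_square continuous_intros)
  then have "integrable (lborel \<Otimes>\<^sub>M lborel) ?f"
    unfolding set_integrable_def lborel_prod .
  from lborel_pair.integral_fst'[OF this]
  have "(LINT z:square p r|lborel. (fst z - fst p) ^ j * (snd z - snd p) ^ k)
    = (\<integral>x. (\<integral>y. ?f (x, y) \<partial>lborel) \<partial>lborel)"
    unfolding set_lebesgue_integral_def lborel_prod by simp
  also have "\<dots> = (\<integral>x. (\<integral>y. ((x - fst p) ^ j * indicator {fst p - r..fst p + r} x) *
      ((y - snd p) ^ k * indicator {snd p - r..snd p + r} y) \<partial>lborel) \<partial>lborel)"
    by (intro Bochner_Integration.integral_cong) (auto simp: square_def indicator_def)
  also have "\<dots> = (\<integral>x. ((x - fst p) ^ j * indicator {fst p - r..fst p + r} x) *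
      ((r ^ Suc k - (- r) ^ Suc k) / Suc k) \<partial>lborel)"
    by (simp only: integral_mult_right_zero one)
  finally show ?thesis
    by (simp only: integral_mult_left_zero one)
qed

lemma measure_square:
  assumes "r \<ge> 0"
  shows "measure lborel (square p r) = 4 * r\<^sup>2"
proof -
  have "(LINT z:square p r|lborel. 1) = 4 * r\<^sup>2"
    using set_integral_square_monomial[OF assms, of p 0 0] by (simp add: power2_eq_square)
  then show ?thesis by (simp add: set_lebesgue_integral_def)
qed

lemma norm_square_le:
  assumes "z \<in> square p r"
  shows "norm (z - p) \<le> 2 * r"
proof -
  have "norm (z - p) \<le> \<bar>fst (z - p)\<bar> + \<bar>snd (z - p)\<bar>"
    using norm_Pair_le[of "fst (z - p)" "snd (z - p)"] by (simp del: fst_diff snd_diff)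
  also have "\<dots> \<le> 2 * r" using assms by (auto simp: square_def)
  finally show ?thesis .
qed

lemma set_integral_square_smallo:
  fixes R :: "real \<times> real \<Rightarrow> real"
  assumes "R \<in> o[nhds p](\<lambda>z. norm (z - p) ^ k)"
  shows "((\<lambda>r. (LINT z:square p r|lborel. R z) / r ^ (k + 2)) \<longlongrightarrow> 0) (at_right 0)"
proof (rule tendstoI)
  fix \<epsilon> :: real assume \<epsilon>: "\<epsilon> > 0"
  \<comment> \<open>The area \<open>4 * r\<^sup>2\<close> times the bound
    \<open>\<delta> * (2 * r) ^ k\<close> then equals
    \<open>\<epsilon> / 2 * r ^ (k + 2)\<close>.\<close>
  define \<delta> where "\<delta> = \<epsilon> / (8 * 2 ^ k)"
  have \<delta>: "\<delta> > 0" using \<epsilon> by (simp add: \<delta>_def)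
  from landau_o.smallD[OF assms \<delta>] obtain d where d: "d > 0"
    and R: "\<And>z. dist z p < d \<Longrightarrow> \<bar>R z\<bar> \<le> \<delta> * norm (z - p) ^ k"
    unfolding eventually_nhds_metric by auto
  have "dist ((LINT z:square p r|lborel. R z) / r ^ (k + 2)) 0 < \<epsilon>" if r: "0 < r" "r < d / 2" for r
  proof -
    have bound: "\<bar>R z\<bar> \<le> \<delta> * (2 * r) ^ k" if "z \<in> square p r" for z
    proof -
      have n: "norm (z - p) \<le> 2 * r" using that by (rule norm_square_le)
      have "\<bar>R z\<bar> \<le> \<delta> * norm (z - p) ^ k"
        using n r by (intro R) (auto simp: dist_norm)
      also have "\<dots> \<le> \<delta> * (2 * r) ^ k"
        using n \<delta> by (intro mult_left_mono power_mono) auto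
      finally show ?thesis .
    qed
    have "\<bar>LINT z:square p r|lborel. R z\<bar> \<le> (LINT z|lborel. \<bar>indicator (square p r) z *\<^sub>R R z\<bar>)"
      unfolding set_lebesgue_integral_def by (rule integral_abs_bound)
    \<comment> \<open>\<open>R\<close> carries no measurability assumption.
      \<open>integral_mono'\<close> asks for integrability of the dominating function only: a
      nonintegrable function has integral 0, which a nonnegative bound dominates anyway.\<close>
    also have "\<dots> \<le> (LINT z|lborel. indicator (square p r) z *\<^sub>R (\<delta> * (2 * r) ^ k))"
    proof (rule integral_mono')
      show "integrable lborel (\<lambda>z. indicator (square p r) z *\<^sub>R (\<delta> * (2 * r) ^ k))"
        using set_integrable_square[of "\<lambda>_. \<delta> * (2 * r) ^ k" p r] by (simp add: set_integrable_def)
    qed (use bound r \<delta> in \<open>auto simp: indicator_def\<close>)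
    also have "\<dots> = 4 * r\<^sup>2 * (\<delta> * (2 * r) ^ k)"
      using r by (simp add: measure_square)
    also have "\<dots> = \<epsilon> / 2 * r ^ (k + 2)"
      by (simp add: \<delta>_def field_simps power_add power2_eq_square)
    finally have "\<bar>LINT z:square p r|lborel. R z\<bar> \<le> \<epsilon> / 2 * r ^ (k + 2)" .
    then have "\<bar>(LINT z:square p r|lborel. R z) / r ^ (k + 2)\<bar> \<le> \<epsilon> / 2"
      using r by (simp add: divide_le_eq del: power_add power_Suc)
    then show ?thesis using \<epsilon> unfolding dist_real_def diff_zero by linarith
  qed
  then show "eventually (\<lambda>r. dist ((LINT z:square p r|lborel. R z) / r ^ (k + 2)) 0 < \<epsilon>) (at_right 0)"
    using d by (auto simp: eventually_at_right_field intro!: exI[of _ "d / 2"])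
qed

text \<open>Continuity at \<open>p\<close> says that \<open>f z - f p\<close> is little-o of
  \<open>norm (z - p) ^ 0\<close>, so this is the case \<open>k = 0\<close> of the preceding
  estimate.\<close>

lemma tendsto_average_square:
  fixes f :: "real \<times> real \<Rightarrow> real"
  assumes int: "integrable lborel f" and cont: "isCont f p"
  shows "((\<lambda>r. (LINT z:square p r|lborel. f z) / (4 * r\<^sup>2)) \<longlongrightarrow> f p) (at_right 0)"
proof -
  have "((\<lambda>z. f z - f p) \<longlongrightarrow> 0) (nhds p)"
    using cont by (auto simp: continuous_at tendsto_at_iff_tendsto_nhds intro: LIM_zero)
  then have "(\<lambda>z. f z - f p) \<in> o[nhds p](\<lambda>z. norm (z - p) ^ 0)"
    by (auto intro!: smalloI_tendsto)
  from set_integral_square_smallo[OF this]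
  have lim: "((\<lambda>r. (LINT z:square p r|lborel. f z - f p) / r\<^sup>2 / 4 + f p) \<longlongrightarrow> 0 / 4 + f p) (at_right 0)"
    by (intro tendsto_intros) (simp_all add: numeral_eq_Suc)
  have "(LINT z:square p r|lborel. f z - f p) / r\<^sup>2 / 4 + f p
      = (LINT z:square p r|lborel. f z) / (4 * r\<^sup>2)" if "r > 0" for r
  proof -
    have "set_integrable lborel (square p r) f"
      using int unfolding set_integrable_def by (intro integrable_mult_indicator) auto
    then have "(LINT z:square p r|lborel. f z - f p) = (LINT z:square p r|lborel. f z) - f p * (4 * r\<^sup>2)"
      using that by (subst set_integral_diff) (auto intro!: set_integrable_square simp: measure_square set_lebesgue_integral_def)
    then show ?thesis using that by (simp add: field_simps)
  qed
  then have "eventually (\<lambda>r. (LINT z:square p r|lborel. f z - f p) / r\<^sup>2 / 4 + f p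
      = (LINT z:square p r|lborel. f z) / (4 * r\<^sup>2)) (at_right 0)"
    by (intro eventually_mono[OF eventually_at_right_less])
  from Lim_transform_eventually[OF lim this] show ?thesis
    by (simp only: div_0 add_0_left)
qed

text \<open>The linear and the mixed terms integrate to zero by symmetry.\<close>

lemma tendsto_set_integral_square_second_order:
  fixes f :: "real \<times> real \<Rightarrow> real"
  assumes int: "integrable lborel f"
    and expansion: "(\<lambda>z. f z - (\<alpha>\<^sub>1 * (fst z - fst p) + \<alpha>\<^sub>2 * (snd z - snd p)
        + (\<kappa>\<^sub>1 * (fst z - fst p)\<^sup>2 + \<kappa> * ((fst z - fst p) * (snd z - snd p)) + \<kappa>\<^sub>2 * (snd z - snd p)\<^sup>2)))
      \<in> o[nhds p](\<lambda>z. norm (z - p) ^ 2)"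
  shows "((\<lambda>r. (LINT z:square p r|lborel. f z) / (4 * r ^ 4)) \<longlongrightarrow> (\<kappa>\<^sub>1 + \<kappa>\<^sub>2) / 3) (at_right 0)"
proof -
  \<comment> \<open>The exponents 0 and 1 are written out so that every term matches
    \<open>set_integral_square_monomial\<close> literally.\<close>
  define q where "q z = \<alpha>\<^sub>1 * ((fst z - fst p) ^ 1 * (snd z - snd p) ^ 0)
    + \<alpha>\<^sub>2 * ((fst z - fst p) ^ 0 * (snd z - snd p) ^ 1)
    + (\<kappa>\<^sub>1 * ((fst z - fst p) ^ 2 * (snd z - snd p) ^ 0) + \<kappa> * ((fst z - fst p) ^ 1 * (snd z - snd p) ^ 1)
      + \<kappa>\<^sub>2 * ((fst z - fst p) ^ 0 * (snd z - snd p) ^ 2))" for z :: "real \<times> real"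
  have q: "set_integrable lborel (square p r) q" for r
    unfolding q_def by (intro set_integrable_square continuous_intros)
  have mono: "set_integrable lborel (square p r) (\<lambda>z. a * ((fst z - fst p) ^ j * (snd z - snd p) ^ k))"
    for r a j k by (intro set_integrable_square continuous_intros)
  \<comment> \<open>A pure square integrates to \<open>(2 * r ^ 3 / 3) * (2 * r)\<close>, one third
    of \<open>r\<^sup>2\<close> times the area. This third is the origin of the constants 1/6 and
    1/3 in \<beta>.\<close>
  have q_integral: "(LINT z:square p r|lborel. q z) = (\<kappa>\<^sub>1 + \<kappa>\<^sub>2) / 3 * (4 * r ^ 4)" if "r > 0" for r
    using that unfolding q_def
    by (simp only: set_integral_add mono set_integral_mult_right set_integral_square_monomial[OF less_imp_le[OF that]])
       (simp add: eval_nat_numeral field_simps)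
  have "(\<lambda>z. f z - q z) \<in> o[nhds p](\<lambda>z. norm (z - p) ^ 2)"
    using expansion by (simp add: q_def)
  from set_integral_square_smallo[OF this]
  have lim: "((\<lambda>r. (LINT z:square p r|lborel. f z - q z) / r ^ 4 / 4 + (\<kappa>\<^sub>1 + \<kappa>\<^sub>2) / 3) \<longlongrightarrow> 0 / 4 + (\<kappa>\<^sub>1 + \<kappa>\<^sub>2) / 3) (at_right 0)"
    by (intro tendsto_intros) (simp_all add: numeral_eq_Suc)
  have "(LINT z:square p r|lborel. f z - q z) / r ^ 4 / 4 + (\<kappa>\<^sub>1 + \<kappa>\<^sub>2) / 3
      = (LINT z:square p r|lborel. f z) / (4 * r ^ 4)" if "r > 0" for r
  proof -
    have "set_integrable lborel (square p r) f"
      using int unfolding set_integrable_def by (intro integrable_mult_indicator) auto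
    then have "(LINT z:square p r|lborel. f z - q z) = (LINT z:square p r|lborel. f z) - (\<kappa>\<^sub>1 + \<kappa>\<^sub>2) / 3 * (4 * r ^ 4)"
      using that q by (simp only: set_integral_diff q_integral)
    then show ?thesis using that by (simp add: field_simps)
  qed
  then have "eventually (\<lambda>r. (LINT z:square p r|lborel. f z - q z) / r ^ 4 / 4 + (\<kappa>\<^sub>1 + \<kappa>\<^sub>2) / 3
      = (LINT z:square p r|lborel. f z) / (4 * r ^ 4)) (at_right 0)"
    by (intro eventually_mono[OF eventually_at_right_less])
  from Lim_transform_eventually[OF lim this] show ?thesis
    by (simp only: div_0 add_0_left)
qed

subsection \<open>Normal limits of triangular arrays\<close>

lemma distr_normal_affine:
  assumes "\<sigma> > 0" "\<alpha> \<noteq> 0"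
  shows "distr (density lborel (normal_density \<mu> \<sigma>)) borel (\<lambda>x. \<beta> + \<alpha> * x)
    = density lborel (normal_density (\<beta> + \<alpha> * \<mu>) (\<bar>\<alpha>\<bar> * \<sigma>))"
proof -
  interpret N: prob_space "density lborel (normal_density \<mu> \<sigma>)"
    using assms by (intro prob_space_normal_density)
  have "distributed (density lborel (normal_density \<mu> \<sigma>)) lborel (\<lambda>x. x) (normal_density \<mu> \<sigma>)"
    by (auto simp: distributed_def distr_id2)
  from N.normal_density_affine[OF this assms] have "distr (density lborel (normal_density \<mu> \<sigma>)) lborel (\<lambda>x. \<beta> + \<alpha> * x)
    = density lborel (normal_density (\<beta> + \<alpha> * \<mu>) (\<bar>\<alpha>\<bar> * \<sigma>))"
    by (auto simp: distributed_def)
  then show ?thesis by (simp cong: distr_cong)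
qed

lemma real_distribution_normal:
  assumes "\<sigma> > 0"
  shows "real_distribution (density lborel (normal_density \<mu> \<sigma>))"
  using prob_space_normal_density[OF assms]
  by (auto simp: real_distribution_def real_distribution_axioms_def)

text \<open>The sums attached to different levels \<open>x\<close> have limits that differ by a
  translation; this expresses all of them through one distribution function.\<close>

lemma cdf_normal_shift:
  assumes "\<sigma> > 0"
  shows "cdf (density lborel (normal_density (\<mu> - x) \<sigma>)) y = cdf (density lborel (normal_density \<mu> \<sigma>)) (y + x)"
proof -
  have "density lborel (normal_density (\<mu> - x) \<sigma>)
      = distr (density lborel (normal_density \<mu> \<sigma>)) borel (\<lambda>z. - x + 1 * z)"
    using assms by (subst distr_normal_affine) simp_all
  also have "cdf \<dots> y = measure (density lborel (normal_density \<mu> \<sigma>)) ((\<lambda>z. - x + 1 * z) -` {..y} \<inter> UNIV)"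
    unfolding cdf_def by (subst measure_distr) simp_all
  also have "(\<lambda>z. - x + 1 * z) -` {..y} \<inter> UNIV = {..y + x}" by auto
  finally show ?thesis by (simp add: cdf_def)
qed

lemma isCont_cdf_normal:
  assumes "\<sigma> > 0"
  shows "isCont (cdf (density lborel (normal_density \<mu> \<sigma>))) x"
proof -
  interpret N: real_distribution "density lborel (normal_density \<mu> \<sigma>)"
    using assms by (rule real_distribution_normal)
  have "emeasure (density lborel (normal_density \<mu> \<sigma>)) {x} = 0"
    by (subst emeasure_density) (auto simp: nn_integral_0_iff_AE intro!: AE_I[where N="{x}"])
  then show ?thesis unfolding N.isCont_cdf measure_def by simp
qed

text \<open>An affine image of the standard normal law. The exponent is kept as one complex number
  because the central limit theorem divides it by \<open>n\<close>.\<close>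

lemma char_normal:
  assumes "\<sigma> > 0"
  shows "char (density lborel (normal_density \<mu> \<sigma>)) t
    = exp (complex_of_real (- (t\<^sup>2 * \<sigma>\<^sup>2 / 2)) + \<i> * complex_of_real (t * \<mu>))"
proof -
  have "density lborel (normal_density \<mu> \<sigma>) = distr std_normal_distribution borel (\<lambda>x. \<mu> + \<sigma> * x)"
    using assms by (subst distr_normal_affine) simp_all
  also have "char \<dots> t = (CLINT x|std_normal_distribution. iexp (t * \<mu>) * iexp (t * \<sigma> * x))"
    unfolding char_def by (subst integral_distr) (simp_all add: algebra_simps flip: exp_add)
  also have "\<dots> = iexp (t * \<mu>) * char std_normal_distribution (t * \<sigma>)"
    unfolding char_def by (subst integral_mult_right_zero) simp
  also have "\<dots> = exp (complex_of_real (- (t\<^sup>2 * \<sigma>\<^sup>2 / 2)) + \<i> * complex_of_real (t * \<mu>))"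
    unfolding char_std_normal_distribution
    by (simp add: exp_of_real[symmetric] power_mult_distrib mult_ac flip: exp_add)
  finally show ?thesis .
qed

text \<open>The characteristic function of the sum is a product of \<open>n\<close> factors, and the
  limit is the product of \<open>n\<close> copies of \<open>exp (\<zeta> / n)\<close>. All factors
  have norm at most 1, so the products differ by at most the sum of the differences of the factors.
  The bound \<open>b n\<close> plays the role of a Lindeberg condition: third absolute moments are
  at most \<open>b n * v n\<close>, and \<open>n\<close> of them sum to something that vanishes. The
  variables are not centred; their means of order 1/n build up to \<mu>. Raw second moments may
  stand for variances because \<open>n * (m n)\<^sup>2\<close> tends to 0.\<close>

theorem (in prob_space) central_limit_theorem_bounded_array:
  fixes Z :: "nat \<Rightarrow> nat \<Rightarrow> 'a \<Rightarrow> real"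
    and b m v :: "nat \<Rightarrow> real" and \<mu> \<sigma> :: real
  assumes indep: "\<And>n. indep_vars (\<lambda>_. borel) (Z n) {..<n}"
    and bound: "\<And>n i \<omega>. i < n \<Longrightarrow> \<omega> \<in> space M \<Longrightarrow> \<bar>Z n i \<omega>\<bar> \<le> b n" and b: "b \<longlonglongrightarrow> 0"
    and mean: "\<And>n i. i < n \<Longrightarrow> expectation (Z n i) = m n" and m: "(\<lambda>n. n * m n) \<longlonglongrightarrow> \<mu>"
    and second: "\<And>n i. i < n \<Longrightarrow> expectation (\<lambda>\<omega>. (Z n i \<omega>)\<^sup>2) = v n" and v: "(\<lambda>n. n * v n) \<longlonglongrightarrow> \<sigma>\<^sup>2"
    and \<sigma>: "\<sigma> > 0"
  shows "weak_conv_m (\<lambda>n. distr M borel (\<lambda>\<omega>. \<Sum>i<n. Z n i \<omega>)) (density lborel (normal_density \<mu> \<sigma>))"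
proof (rule levy_continuity)
  have rv: "random_variable borel (Z n i)" if "i < n" for n i
    using indep[of n] that by (auto simp: indep_vars_def)
  show "real_distribution (distr M borel (\<lambda>\<omega>. \<Sum>i<n. Z n i \<omega>))" for n
    using rv by (intro real_distribution_distr borel_measurable_sum) auto
  show "real_distribution (density lborel (normal_density \<mu> \<sigma>))"
    using \<sigma> by (rule real_distribution_normal)
  fix t :: real
  define \<zeta> where "\<zeta> = complex_of_real (- (t\<^sup>2 * \<sigma>\<^sup>2 / 2)) + \<i> * complex_of_real (t * \<mu>)"
  \<comment> \<open>\<open>K\<close> comes from the remainder of \<open>exp\<close> at
    \<open>\<zeta> / n\<close>, bounded by \<open>exp \<bar>Re (\<zeta> / n)\<bar> * (norm (\<zeta>
    / n))\<^sup>2\<close>, with the real part at its largest for \<open>n = 1\<close>.\<close>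
  define K where "K = exp (t\<^sup>2 * \<sigma>\<^sup>2 / 2) * (norm \<zeta>)\<^sup>2"
  have factor: "norm (char (distr M borel (Z n i)) t - exp (\<zeta> / n))
      \<le> \<bar>t\<bar> * \<bar>m n - \<mu> / n\<bar> + t\<^sup>2 / 2 * \<bar>v n - \<sigma>\<^sup>2 / n\<bar> + \<bar>t\<bar> ^ 3 / 6 * (b n * v n) + K / (real n)\<^sup>2"
    if i: "i < n" for n i
  proof -
    have [measurable]: "Z n i \<in> borel_measurable M" using i by (rule rv)
    interpret D: real_distribution "distr M borel (Z n i)" by (intro real_distribution_distr) simp
    have int: "integrable M (\<lambda>\<omega>. Z n i \<omega> ^ k)" for k
      using bound[OF i] by (intro integrable_const_bound[where B = "b n ^ k"])
         (auto simp: power_abs intro!: AE_I2 power_mono)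
    have b_nonneg: "0 \<le> b n"
    proof -
      obtain \<omega> where "\<omega> \<in> space M" using not_empty by blast
      then show ?thesis using bound[OF i, of \<omega>] by linarith
    qed
    have "norm (char (distr M borel (Z n i)) t
          - (\<Sum>k\<le>2. ((\<i> * t) ^ k / fact k) * D.expectation (\<lambda>x. x ^ k)))
        \<le> \<bar>t\<bar> ^ 2 / fact (Suc 2) * D.expectation (\<lambda>x. min (2 * \<bar>x\<bar> ^ 2 * Suc 2) (\<bar>t\<bar> * \<bar>x\<bar> ^ Suc 2))"
      by (rule D.char_approx2) (use int in \<open>simp add: integrable_distr_eq\<close>)
    also have "(\<Sum>k\<le>2. ((\<i> * t) ^ k / fact k) * D.expectation (\<lambda>x. x ^ k))
        = 1 + \<i> * t * m n - t\<^sup>2 / 2 * v n"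
      using mean[OF i] second[OF i] prob_space
      by (simp add: integral_distr numeral_2_eq_2 del: One_nat_def) (simp add: power2_eq_square complex_eq_iff)
    also have "D.expectation (\<lambda>x. min (2 * \<bar>x\<bar> ^ 2 * Suc 2) (\<bar>t\<bar> * \<bar>x\<bar> ^ Suc 2))
        = expectation (\<lambda>\<omega>. min (2 * \<bar>Z n i \<omega>\<bar> ^ 2 * Suc 2) (\<bar>t\<bar> * \<bar>Z n i \<omega>\<bar> ^ Suc 2))"
      by (subst integral_distr) simp_all
    \<comment> \<open>Only the cubic branch of \<open>min\<close> is used; one of its three factors
      is bounded by \<open>b n\<close>.\<close>
    also have "\<dots> \<le> expectation (\<lambda>\<omega>. \<bar>t\<bar> * b n * (Z n i \<omega>)\<^sup>2)"
    proof (rule integral_mono')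
      fix \<omega> assume "\<omega> \<in> space M"
      then have "\<bar>Z n i \<omega>\<bar> * (Z n i \<omega>)\<^sup>2 \<le> b n * (Z n i \<omega>)\<^sup>2"
        using bound[OF i] by (intro mult_right_mono) auto
      then have "\<bar>t\<bar> * \<bar>Z n i \<omega>\<bar> ^ Suc 2 \<le> \<bar>t\<bar> * b n * (Z n i \<omega>)\<^sup>2"
        by (simp only: power_Suc power2_abs mult.assoc) (rule mult_left_mono, auto)
      then show "min (2 * \<bar>Z n i \<omega>\<bar> ^ 2 * Suc 2) (\<bar>t\<bar> * \<bar>Z n i \<omega>\<bar> ^ Suc 2) \<le> \<bar>t\<bar> * b n * (Z n i \<omega>)\<^sup>2"
        by linarith
    qed (use int b_nonneg in auto)
    also have "\<dots> = \<bar>t\<bar> * b n * v n"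
      using second[OF i] by simp
    also have "\<bar>t\<bar> ^ 2 / fact (Suc 2) * (\<bar>t\<bar> * b n * v n) = \<bar>t\<bar> ^ 3 / 6 * (b n * v n)"
      by (simp add: fact_numeral eval_nat_numeral)
    \<comment> \<open>The last inequality was chained underneath a constant factor, so the
      calculation carries a monotonicity premise; \<open>mult_left_mono\<close> discharges
      it.\<close>
    finally have 1: "norm (char (distr M borel (Z n i)) t - (1 + \<i> * t * m n - t\<^sup>2 / 2 * v n))
        \<le> \<bar>t\<bar> ^ 3 / 6 * (b n * v n)"
      by - (erule meta_mp, rule mult_left_mono, simp_all)
    have "norm (exp (\<zeta> / n) - (1 + \<zeta> / n)) \<le> exp \<bar>Re (\<zeta> / n)\<bar> * (norm (\<zeta> / n))\<^sup>2"
      using Taylor_exp[of "\<zeta> / n" 1] by (simp add: numeral_2_eq_2)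
    also have "\<dots> \<le> exp (t\<^sup>2 * \<sigma>\<^sup>2 / 2) * (norm (\<zeta> / n))\<^sup>2"
    proof (intro mult_right_mono)
      have "\<bar>Re (\<zeta> / n)\<bar> = t\<^sup>2 * \<sigma>\<^sup>2 / 2 / n" by (simp add: \<zeta>_def)
      also have "\<dots> \<le> t\<^sup>2 * \<sigma>\<^sup>2 / 2 / 1" using i by (intro divide_left_mono) auto
      finally show "exp \<bar>Re (\<zeta> / n)\<bar> \<le> exp (t\<^sup>2 * \<sigma>\<^sup>2 / 2)" by simp
    qed simp
    also have "\<dots> = K / (real n)\<^sup>2"
      by (simp add: K_def norm_divide power_divide)
    finally have 2: "norm (exp (\<zeta> / n) - (1 + \<zeta> / n)) \<le> K / (real n)\<^sup>2" .
    have "(1 + \<i> * t * m n - t\<^sup>2 / 2 * v n) - (1 + \<zeta> / n)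
        = \<i> * complex_of_real (t * (m n - \<mu> / n)) - complex_of_real (t\<^sup>2 / 2 * (v n - \<sigma>\<^sup>2 / n))"
      by (simp add: complex_eq_iff \<zeta>_def right_diff_distrib)
    also have "norm \<dots> \<le> \<bar>t\<bar> * \<bar>m n - \<mu> / n\<bar> + t\<^sup>2 / 2 * \<bar>v n - \<sigma>\<^sup>2 / n\<bar>"
      by (rule order_trans[OF norm_triangle_ineq4]) (simp only: norm_mult norm_ii norm_of_real abs_mult, simp)
    finally have 3: "norm ((1 + \<i> * t * m n - t\<^sup>2 / 2 * v n) - (1 + \<zeta> / n))
        \<le> \<bar>t\<bar> * \<bar>m n - \<mu> / n\<bar> + t\<^sup>2 / 2 * \<bar>v n - \<sigma>\<^sup>2 / n\<bar>" .
    have "norm (x - y) \<le> norm (p - q) + norm (x - p) + norm (y - q)" for x y p q :: complex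
    proof -
      have "x - y = (p - q) + ((x - p) - (y - q))" by simp
      also have "norm \<dots> \<le> norm (p - q) + norm ((x - p) - (y - q))" by (rule norm_triangle_ineq)
      also have "norm ((x - p) - (y - q)) \<le> norm (x - p) + norm (y - q)" by (rule norm_triangle_ineq4)
      finally show ?thesis by simp
    qed
    from order_trans[OF this add_mono[OF add_mono[OF 3 1] 2]] show ?thesis by simp
  qed
  have estimate: "norm (char (distr M borel (\<lambda>\<omega>. \<Sum>i<n. Z n i \<omega>)) t - exp \<zeta>)
      \<le> \<bar>t\<bar> * \<bar>n * m n - \<mu>\<bar> + t\<^sup>2 / 2 * \<bar>n * v n - \<sigma>\<^sup>2\<bar> + \<bar>t\<bar> ^ 3 / 6 * (b n * (n * v n)) + K / n"
    if n: "n > 0" for n :: nat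
  proof -
    have "exp \<zeta> = (\<Prod>i<n. exp (\<zeta> / n))"
      using n by (simp flip: exp_of_nat_mult)
    then have "norm (char (distr M borel (\<lambda>\<omega>. \<Sum>i<n. Z n i \<omega>)) t - exp \<zeta>)
        = norm ((\<Prod>i<n. char (distr M borel (Z n i)) t) - (\<Prod>i<n. exp (\<zeta> / n)))"
      by (simp only: char_distr_sum[OF indep])
    also have "\<dots> \<le> (\<Sum>i<n. norm (char (distr M borel (Z n i)) t - exp (\<zeta> / n)))"
    proof (rule norm_prod_diff)
      show "norm (char (distr M borel (Z n i)) t) \<le> 1" if "i \<in> {..<n}" for i
        using that rv by (intro real_distribution.cmod_char_le_1 real_distribution_distr) auto
      show "norm (exp (\<zeta> / n)) \<le> 1" by (simp add: \<zeta>_def)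
    qed
    also have "\<dots> \<le> (\<Sum>i<n. \<bar>t\<bar> * \<bar>m n - \<mu> / n\<bar> + t\<^sup>2 / 2 * \<bar>v n - \<sigma>\<^sup>2 / n\<bar>
        + \<bar>t\<bar> ^ 3 / 6 * (b n * v n) + K / (real n)\<^sup>2)"
      by (intro sum_mono factor) auto
    also have "\<dots> = \<bar>t\<bar> * (n * \<bar>m n - \<mu> / n\<bar>) + t\<^sup>2 / 2 * (n * \<bar>v n - \<sigma>\<^sup>2 / n\<bar>)
        + \<bar>t\<bar> ^ 3 / 6 * (b n * (n * v n)) + K / n"
      using n by (simp add: field_simps power2_eq_square)
    also have "n * \<bar>m n - \<mu> / n\<bar> = \<bar>n * (m n - \<mu> / n)\<bar>"
      by (simp add: abs_mult)
    also have "n * \<bar>v n - \<sigma>\<^sup>2 / n\<bar> = \<bar>n * (v n - \<sigma>\<^sup>2 / n)\<bar>"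
      by (simp add: abs_mult)
    finally show ?thesis using n by (simp add: right_diff_distrib)
  qed
  have "(\<lambda>n. \<bar>t\<bar> * \<bar>n * m n - \<mu>\<bar> + t\<^sup>2 / 2 * \<bar>n * v n - \<sigma>\<^sup>2\<bar> + \<bar>t\<bar> ^ 3 / 6 * (b n * (n * v n)) + K / n) \<longlonglongrightarrow>
      \<bar>t\<bar> * \<bar>\<mu> - \<mu>\<bar> + t\<^sup>2 / 2 * \<bar>\<sigma>\<^sup>2 - \<sigma>\<^sup>2\<bar> + \<bar>t\<bar> ^ 3 / 6 * (0 * \<sigma>\<^sup>2) + 0"
    by (intro tendsto_intros m v b lim_const_over_n)
  then have null: "(\<lambda>n. \<bar>t\<bar> * \<bar>n * m n - \<mu>\<bar> + t\<^sup>2 / 2 * \<bar>n * v n - \<sigma>\<^sup>2\<bar> + \<bar>t\<bar> ^ 3 / 6 * (b n * (n * v n)) + K / n) \<longlonglongrightarrow> 0"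
    by simp
  have "(\<lambda>n. char (distr M borel (\<lambda>\<omega>. \<Sum>i<n. Z n i \<omega>)) t - exp \<zeta>) \<longlonglongrightarrow> 0"
    by (rule Lim_null_comparison[OF eventually_mono[OF eventually_gt_at_top[of "0::nat"] estimate] null])
  then show "(\<lambda>n. char (distr M borel (\<lambda>\<omega>. \<Sum>i<n. Z n i \<omega>)) t) \<longlonglongrightarrow> char (density lborel (normal_density \<mu> \<sigma>)) t"
    using \<sigma> by (simp add: char_normal \<zeta>_def LIM_zero_iff)
qed

text \<open>The bounds are asymmetric because only one of the two inclusions of events needs a
  strict inequality. The lower bound is therefore taken at \<open>x - \<epsilon>\<close>, and
  continuity of \<open>\<Phi>\<close> lets \<epsilon> tend to 0 from the right.\<close>

lemma isCont_sandwich_tendsto: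
  fixes \<Phi> :: "real \<Rightarrow> real"
  assumes cont: "isCont \<Phi> x"
    and lower: "\<And>\<epsilon>. \<epsilon> > 0 \<Longrightarrow> (\<lambda>n. L \<epsilon> n) \<longlonglongrightarrow> \<Phi> (x - \<epsilon>)" and upper: "R \<longlonglongrightarrow> \<Phi> x"
    and le: "\<And>\<epsilon>. \<epsilon> > 0 \<Longrightarrow> eventually (\<lambda>n. L \<epsilon> n \<le> P n \<and> P n \<le> R n) sequentially"
  shows "P \<longlonglongrightarrow> \<Phi> x"
proof (rule order_tendstoI)
  fix y assume "y < \<Phi> x"
  moreover have "((\<lambda>\<epsilon>. \<Phi> (x - \<epsilon>)) \<longlongrightarrow> \<Phi> (x - 0)) (at_right 0)"
    using cont by (intro isCont_tendsto_compose[where g = \<Phi>] tendsto_intros) auto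
  ultimately have "eventually (\<lambda>\<epsilon>. y < \<Phi> (x - \<epsilon>)) (at_right 0)"
    by (intro order_tendstoD(1)) auto
  then have "eventually (\<lambda>\<epsilon>. y < \<Phi> (x - \<epsilon>) \<and> 0 < \<epsilon>) (at_right 0)"
    by (intro eventually_conj eventually_at_right_less)
  then obtain \<epsilon> where \<epsilon>: "\<epsilon> > 0" "y < \<Phi> (x - \<epsilon>)"
    using eventually_happens[of _ "at_right (0 :: real)"] by auto
  show "eventually (\<lambda>n. y < P n) sequentially"
    using order_tendstoD(1)[OF lower[OF \<epsilon>(1)] \<epsilon>(2)] le[OF \<epsilon>(1)] by eventually_elim auto
next
  fix y assume "\<Phi> x < y"
  show "eventually (\<lambda>n. P n < y) sequentially"
    using order_tendstoD(2)[OF upper \<open>\<Phi> x < y\<close>] le[OF zero_less_one] by eventually_elim auto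
qed

subsection \<open>Moments of the local counts\<close>

text \<open>Measurable rectangles form an intersection-stable generator of the product
  sigma-algebra, so the product formula has to be checked on them only.\<close>

lemma (in prob_space) indep_vars_Pair:
  fixes A B :: "'i \<Rightarrow> 'a \<Rightarrow> 'b"
  assumes A: "indep_vars N A UNIV" and B: "indep_vars N' B UNIV"
    and AB: "indep_var (PiM UNIV N) (\<lambda>\<omega> i. A i \<omega>) (PiM UNIV N') (\<lambda>\<omega> i. B i \<omega>)"
    and J: "finite J"
  shows "indep_vars (\<lambda>i. N i \<Otimes>\<^sub>M N' i) (\<lambda>i \<omega>. (A i \<omega>, B i \<omega>)) J"
proof (cases "J = {}")
  case True
  then show ?thesis by (simp add: indep_vars_def indep_sets_def)
next
  case False
  have rvA: "random_variable (N i) (A i)" and rvB: "random_variable (N' i) (B i)" for i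
    using A B by (auto simp: indep_vars_def)
  define E where "E i = {a \<times> b |a b. a \<in> sets (N i) \<and> b \<in> sets (N' i)}" for i
  \<comment> \<open>A rectangle event is a cylinder event of the sequence \<open>A\<close>
    intersected with one of the sequence \<open>B\<close>. These are independent because the
    sequences are so as a whole, and each factors further within its own sequence. Arbitrary
    \<open>K\<close> allows both \<open>J\<close> and singletons; comparing the two gives the
    product formula.\<close>
  have rectangles: "prob (\<Inter>j\<in>K. (\<lambda>\<omega>. (A j \<omega>, B j \<omega>)) -` (a j \<times> b j) \<inter> space M)
      = (\<Prod>j\<in>K. prob (A j -` a j \<inter> space M)) * (\<Prod>j\<in>K. prob (B j -` b j \<inter> space M))"
    if K: "finite K" "K \<noteq> {}" and a: "\<And>j. j \<in> K \<Longrightarrow> a j \<in> sets (N j)" and b: "\<And>j. j \<in> K \<Longrightarrow> b j \<in> sets (N' j)"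
    for K a b
  proof -
    define PA where "PA = {f \<in> space (PiM UNIV N). \<forall>j\<in>K. f j \<in> a j}"
    define PB where "PB = {f \<in> space (PiM UNIV N'). \<forall>j\<in>K. f j \<in> b j}"
    have "PA \<in> sets (PiM UNIV N)" "PB \<in> sets (PiM UNIV N')"
      unfolding PA_def PB_def using K a b
      by (auto intro!: sets.sets_Collect_finite_All sets_Collect_single)
    from indep_varD[OF AB this]
    have "prob ((\<lambda>\<omega>. (\<lambda>i. A i \<omega>, \<lambda>i. B i \<omega>)) -` (PA \<times> PB) \<inter> space M)
      = prob ((\<lambda>\<omega> i. A i \<omega>) -` PA \<inter> space M) * prob ((\<lambda>\<omega> i. B i \<omega>) -` PB \<inter> space M)" .
    also have "(\<lambda>\<omega> i. A i \<omega>) -` PA \<inter> space M = (\<Inter>j\<in>K. A j -` a j \<inter> space M)"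
      using K rvA[THEN measurable_space] by (auto simp: PA_def space_PiM PiE_iff)
    also have "(\<lambda>\<omega> i. B i \<omega>) -` PB \<inter> space M = (\<Inter>j\<in>K. B j -` b j \<inter> space M)"
      using K rvB[THEN measurable_space] by (auto simp: PB_def space_PiM PiE_iff)
    also have "(\<lambda>\<omega>. (\<lambda>i. A i \<omega>, \<lambda>i. B i \<omega>)) -` (PA \<times> PB) \<inter> space M
      = (\<Inter>j\<in>K. (\<lambda>\<omega>. (A j \<omega>, B j \<omega>)) -` (a j \<times> b j) \<inter> space M)"
      using K rvA[THEN measurable_space] rvB[THEN measurable_space]
      by (auto simp: PA_def PB_def space_PiM PiE_iff)
    also have "prob (\<Inter>j\<in>K. A j -` a j \<inter> space M) = (\<Prod>j\<in>K. prob (A j -` a j \<inter> space M))"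
      using K a by (intro indep_varsD[OF A]) auto
    also have "prob (\<Inter>j\<in>K. B j -` b j \<inter> space M) = (\<Prod>j\<in>K. prob (B j -` b j \<inter> space M))"
      using K b by (intro indep_varsD[OF B]) auto
    finally show ?thesis .
  qed
  show ?thesis
  proof (subst indep_vars_finite[where E = E])
    show "J \<noteq> {}" "finite J" by fact+
    show "sets (N i \<Otimes>\<^sub>M N' i) = sigma_sets (space (N i \<Otimes>\<^sub>M N' i)) (E i)" for i
      by (simp add: sets_pair_measure space_pair_measure E_def)
    show "random_variable (N i \<Otimes>\<^sub>M N' i) (\<lambda>\<omega>. (A i \<omega>, B i \<omega>))" for i
      using rvA rvB by (rule measurable_Pair)
    show "Int_stable (E i)" for i
      unfolding E_def by (rule Int_stable_pair_measure_generator)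
    show "space (N i \<Otimes>\<^sub>M N' i) \<in> E i" for i
      by (auto simp: E_def space_pair_measure)
    show "E i \<subseteq> Pow (space (N i \<Otimes>\<^sub>M N' i))" for i
      using pair_measure_closed[of "N i" "N' i"] by (auto simp: E_def space_pair_measure)
    show "\<forall>C\<in>\<Pi> i\<in>J. E i. prob (\<Inter>j\<in>J. (\<lambda>\<omega>. (A j \<omega>, B j \<omega>)) -` C j \<inter> space M)
        = (\<Prod>j\<in>J. prob ((\<lambda>\<omega>. (A j \<omega>, B j \<omega>)) -` C j \<inter> space M))"
    proof
      fix C assume "C \<in> (\<Pi> i\<in>J. E i)"
      then have "\<forall>j\<in>J. \<exists>a b. C j = a \<times> b \<and> a \<in> sets (N j) \<and> b \<in> sets (N' j)"
        by (auto simp: E_def Pi_iff)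
      then obtain a b where ab: "\<And>j. j \<in> J \<Longrightarrow> C j = a j \<times> b j"
          "\<And>j. j \<in> J \<Longrightarrow> a j \<in> sets (N j)" "\<And>j. j \<in> J \<Longrightarrow> b j \<in> sets (N' j)"
        by metis
      have "prob ((\<lambda>\<omega>. (A j \<omega>, B j \<omega>)) -` C j \<inter> space M)
          = prob (A j -` a j \<inter> space M) * prob (B j -` b j \<inter> space M)" if "j \<in> J" for j
        using rectangles[of "{j}" a b] ab that by simp
      then show "prob (\<Inter>j\<in>J. (\<lambda>\<omega>. (A j \<omega>, B j \<omega>)) -` C j \<inter> space M)
          = (\<Prod>j\<in>J. prob ((\<lambda>\<omega>. (A j \<omega>, B j \<omega>)) -` C j \<inter> space M))"
        using rectangles[OF J False, of a b] ab by (simp add: prod.distrib)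
    qed
  qed
qed

lemma closed_Collect_both_le:
  "closed {(h :: real \<times> real, z :: real \<times> real). fst h \<le> fst z \<and> snd h \<le> snd z}"
  by (auto simp: case_prod_unfold intro!: closed_Collect_conj closed_Collect_le continuous_intros)

text \<open>A closed set is Borel in the product space, and \<open>borel_prod\<close> moves this to
  the product sigma-algebra. Fubini needs measurability jointly in the hidden and the observed
  point.\<close>

lemma both_le_measurable [measurable]:
  "(\<lambda>(h, z). of_bool (fst h \<le> fst z \<and> snd h \<le> snd z) :: real)
    \<in> borel_measurable (borel \<Otimes>\<^sub>M (borel :: (real \<times> real) measure))"
proof -
  have "(indicator {(h, z). fst h \<le> fst z \<and> snd h \<le> snd z} :: _ \<Rightarrow> real)
      \<in> borel_measurable (borel :: ((real \<times> real) \<times> real \<times> real) measure)"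
    by (intro borel_measurable_indicator borel_closed closed_Collect_both_le)
  moreover have "indicator {(h, z). fst h \<le> fst z \<and> snd h \<le> snd z}
      = (\<lambda>(h :: real \<times> real, z :: real \<times> real). of_bool (fst h \<le> fst z \<and> snd h \<le> snd z) :: real)"
    by (auto simp: indicator_def fun_eq_iff)
  ultimately show ?thesis by (simp add: borel_prod)
qed

section \<open>Measurability and expectations in the current status model\<close>

context bivariate_current_status
begin

lemma hidden_measurable [measurable]: "(\<lambda>\<omega>. (X i \<omega>, Y i \<omega>)) \<in> borel_measurable M"
  and observation_measurable [measurable]: "(\<lambda>\<omega>. (T i \<omega>, U i \<omega>)) \<in> borel_measurable M"
  using indep_hidden indep_observation by (auto simp: indep_vars_def)

lemma coordinates_measurable [measurable]:
  "X i \<in> borel_measurable M" "Y i \<in> borel_measurable M"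
  "T i \<in> borel_measurable M" "U i \<in> borel_measurable M"
proof -
  have fst: "fst \<in> borel_measurable (borel :: (real \<times> real) measure)"
    and snd: "snd \<in> borel_measurable (borel :: (real \<times> real) measure)"
    by (simp_all flip: borel_prod)
  show "X i \<in> borel_measurable M" "Y i \<in> borel_measurable M"
    "T i \<in> borel_measurable M" "U i \<in> borel_measurable M"
    using measurable_compose[OF hidden_measurable[of i] fst] measurable_compose[OF hidden_measurable[of i] snd]
      measurable_compose[OF observation_measurable[of i] fst] measurable_compose[OF observation_measurable[of i] snd]
    by simp_all
qed

lemma indep_vars_hidden_observation:
  assumes "finite J"
  shows "indep_vars (\<lambda>_. borel \<Otimes>\<^sub>M borel) (\<lambda>i \<omega>. ((X i \<omega>, Y i \<omega>), (T i \<omega>, U i \<omega>))) J"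
  using indep_vars_Pair[OF indep_hidden indep_observation indep_hidden_observation assms] .

lemma indep_var_hidden_observation:
  "indep_var borel (\<lambda>\<omega>. (X i \<omega>, Y i \<omega>)) borel (\<lambda>\<omega>. (T i \<omega>, U i \<omega>))"
  using indep_var_compose[OF indep_hidden_observation, of "\<lambda>f. f i" borel "\<lambda>f. f i" borel]
  by (simp add: comp_def)

lemma density_measurable [measurable]: "g \<in> borel_measurable borel"
  using distributed_real_measurable[OF _ observation_density] density_nonneg by auto

lemma integrable_density: "integrable lborel g"
  using distributed_integrable[OF observation_density[of 0], of "\<lambda>_. 1"] density_nonneg by simp

text \<open>In this form \<open>F0\<close> is an inner integral: its measurability follows as for
  any parametrised integral, and Fubini can recognise it.\<close>

lemma hidden_cdf_integral:
  "F0 z = (\<integral>h. of_bool (fst h \<le> fst z \<and> snd h \<le> snd z) \<partial>distr M borel (\<lambda>\<omega>. (X i \<omega>, Y i \<omega>)))"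
proof -
  have m: "(\<lambda>h. of_bool (fst h \<le> fst z \<and> snd h \<le> snd z) :: real) \<in> borel_measurable borel"
    using measurable_compose[OF _ both_le_measurable, of "\<lambda>h. (h, z)" borel] by simp
  have "(\<integral>h. of_bool (fst h \<le> fst z \<and> snd h \<le> snd z) \<partial>distr M borel (\<lambda>\<omega>. (X i \<omega>, Y i \<omega>)))
      = (\<integral>\<omega>. indicator {\<omega>\<in>space M. X i \<omega> \<le> fst z \<and> Y i \<omega> \<le> snd z} \<omega> \<partial>M :: real)"
    unfolding integral_distr[OF hidden_measurable m] by (auto intro!: Bochner_Integration.integral_cong simp: indicator_def)
  also have "\<dots> = prob {\<omega>\<in>space M. X i \<omega> \<le> fst z \<and> Y i \<omega> \<le> snd z}"
    by simp
  finally show ?thesis using hidden_cdf[of "fst z" "snd z" i] by simp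
qed

lemma hidden_cdf_measurable [measurable]: "F0 \<in> borel_measurable borel"
proof -
  interpret H: prob_space "distr M borel (\<lambda>\<omega>. (X 0 \<omega>, Y 0 \<omega>))"
    by (intro prob_space_distr) simp
  have "(\<lambda>z. (\<integral>h. of_bool (fst h \<le> fst z \<and> snd h \<le> snd z) \<partial>distr M borel (\<lambda>\<omega>. (X 0 \<omega>, Y 0 \<omega>))) :: real)
      \<in> borel_measurable (borel :: (real \<times> real) measure)"
  proof (rule H.borel_measurable_lebesgue_integral)
    have "(\<lambda>(z, h). (h, z)) \<in> borel \<Otimes>\<^sub>M borel \<rightarrow>\<^sub>M borel \<Otimes>\<^sub>M (borel :: (real \<times> real) measure)"
      by (rule measurable_pair_swap')
    from measurable_compose[OF this both_le_measurable]
    show "(\<lambda>(z, h). of_bool (fst h \<le> fst z \<and> snd h \<le> snd z) :: real)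
        \<in> borel_measurable (borel \<Otimes>\<^sub>M distr M borel (\<lambda>\<omega>. (X 0 \<omega>, Y 0 \<omega>)))"
      by (simp add: case_prod_unfold cong: measurable_cong_sets)
  qed
  then show ?thesis by (simp flip: hidden_cdf_integral)
qed

lemma hidden_cdf_bounds: "0 \<le> F0 z" "F0 z \<le> 1"
  using hidden_cdf[of "fst z" "snd z" 0] by simp_all

lemma integrable_hidden_cdf_density: "integrable lborel (\<lambda>z. F0 z * g z)"
  by (rule Bochner_Integration.integrable_bound[OF integrable_density])
     (auto simp: abs_mult hidden_cdf_bounds intro!: mult_left_le_one_le)

lemma expectation_observation:
  assumes [measurable]: "A \<in> sets borel"
  shows "expectation (\<lambda>\<omega>. indicator A (T i \<omega>, U i \<omega>)) = (LINT z:A|lborel. g z)"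
proof -
  have "(\<integral>z. g z * indicator A z \<partial>lborel) = expectation (\<lambda>\<omega>. indicator A (T i \<omega>, U i \<omega>))"
    by (rule distributed_integral[OF observation_density]) (simp_all add: density_nonneg)
  then show ?thesis by (simp add: set_lebesgue_integral_def mult.commute)
qed

text \<open>Given that the observation point is \<open>z\<close>, both indicators equal 1 with
  probability \<open>F0 z\<close>, by independence. Formally, the joint law is the product
  \<open>H \<Otimes>\<^sub>M Q\<close>; integrating out the hidden vector on the inside yields
  \<open>F0\<close>, and the remaining integral is evaluated with the density.\<close>

lemma expectation_hidden_observation:
  assumes [measurable]: "A \<in> sets borel"
  shows "expectation (\<lambda>\<omega>. of_bool (X i \<omega> \<le> T i \<omega>) * of_bool (Y i \<omega> \<le> U i \<omega>) * indicator A (T i \<omega>, U i \<omega>))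
    = (LINT z:A|lborel. F0 z * g z)"
proof -
  define H where "H = distr M borel (\<lambda>\<omega>. (X i \<omega>, Y i \<omega>))"
  define Q where "Q = distr M borel (\<lambda>\<omega>. (T i \<omega>, U i \<omega>))"
  define \<phi> :: "real \<times> real \<Rightarrow> real \<times> real \<Rightarrow> real" where
    "\<phi> h z = of_bool (fst h \<le> fst z \<and> snd h \<le> snd z) * indicator A z" for h z
  interpret H: prob_space H unfolding H_def by (intro prob_space_distr) simp
  interpret Q: prob_space Q unfolding Q_def by (intro prob_space_distr) simp
  interpret HQ: pair_prob_space H Q ..
  have \<phi>: "case_prod \<phi> \<in> borel_measurable (borel \<Otimes>\<^sub>M borel)"
    using borel_measurable_times[OF both_le_measurable, of "\<lambda>(h, z). indicator A z"]
    by (simp add: \<phi>_def case_prod_unfold)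
  have joint: "H \<Otimes>\<^sub>M Q = distr M (borel \<Otimes>\<^sub>M borel) (\<lambda>\<omega>. ((X i \<omega>, Y i \<omega>), (T i \<omega>, U i \<omega>)))"
    using indep_var_hidden_observation unfolding indep_var_distribution_eq H_def Q_def by blast
  have "integrable (H \<Otimes>\<^sub>M Q) (case_prod \<phi>)"
    using \<phi> by (intro HQ.P.integrable_const_bound[where B = 1]) (auto simp: joint \<phi>_def indicator_def)
  have "expectation (\<lambda>\<omega>. of_bool (X i \<omega> \<le> T i \<omega>) * of_bool (Y i \<omega> \<le> U i \<omega>) * indicator A (T i \<omega>, U i \<omega>))
      = expectation (\<lambda>\<omega>. case_prod \<phi> ((X i \<omega>, Y i \<omega>), (T i \<omega>, U i \<omega>)))"
    by (simp add: \<phi>_def of_bool_conj)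
  also have "\<dots> = integral\<^sup>L (H \<Otimes>\<^sub>M Q) (case_prod \<phi>)"
    unfolding joint using \<phi> by (subst integral_distr) auto
  also have "\<dots> = (\<integral>z. (\<integral>h. \<phi> h z \<partial>H) \<partial>Q)"
    by (rule HQ.integral_snd[symmetric]) fact
  also have "\<dots> = (\<integral>z. F0 z * indicator A z \<partial>Q)"
    by (simp add: \<phi>_def hidden_cdf_integral[of _ i] H_def)
  also have "\<dots> = expectation (\<lambda>\<omega>. F0 (T i \<omega>, U i \<omega>) * indicator A (T i \<omega>, U i \<omega>))"
    unfolding Q_def by (subst integral_distr) simp_all
  also have "\<dots> = (\<integral>z. g z * (F0 z * indicator A z) \<partial>lborel)"
    by (rule distributed_integral[OF observation_density, symmetric]) (simp_all add: density_nonneg)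
  finally show ?thesis by (simp add: set_lebesgue_integral_def mult_ac)
qed

text \<open>Makes \<sigma>2 positive. The corners (0, 0) and (1, 1) belong to the support, so the
  open quadrants below and above (t, u) both carry mass.\<close>

lemma hidden_cdf_interior:
  assumes "(t, u) \<in> interior ({0..1} \<times> {0..1})"
  shows "0 < F0 (t, u)" "F0 (t, u) < 1"
proof -
  have tu: "0 < t" "t < 1" "0 < u" "u < 1"
    using assms by (auto simp: interior_Times)
  have mass: "0 < prob {\<omega>\<in>space M. (X 0 \<omega>, Y 0 \<omega>) \<in> S}"
    if S: "open S" "q \<in> S" and q: "q \<in> {0..1} \<times> {0..1}" for S q
  proof -
    have "q \<in> topological_support (distr M borel (\<lambda>\<omega>. (X 0 \<omega>, Y 0 \<omega>)))"
      using q by (simp add: hidden_support)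
    then have "0 < emeasure (distr M borel (\<lambda>\<omega>. (X 0 \<omega>, Y 0 \<omega>))) S"
      using S by (auto simp: topological_support_def)
    also have "\<dots> = emeasure M {\<omega>\<in>space M. (X 0 \<omega>, Y 0 \<omega>) \<in> S}"
      using S by (subst emeasure_distr) (auto intro!: arg_cong[where f="emeasure M"])
    finally show ?thesis by (simp add: emeasure_eq_measure)
  qed
  have F0: "F0 (t, u) = prob {\<omega>\<in>space M. X 0 \<omega> \<le> t \<and> Y 0 \<omega> \<le> u}"
    by (rule hidden_cdf)
  have "0 < prob {\<omega>\<in>space M. (X 0 \<omega>, Y 0 \<omega>) \<in> {..<t} \<times> {..<u}}"
    using tu by (intro mass[of _ "(0, 0)"] open_Times) auto
  also have "\<dots> \<le> F0 (t, u)"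
    unfolding F0 by (intro finite_measure_mono) auto
  finally show "0 < F0 (t, u)" .
  have "0 < prob {\<omega>\<in>space M. (X 0 \<omega>, Y 0 \<omega>) \<in> {t<..} \<times> {u<..}}"
    using tu by (intro mass[of _ "(1, 1)"] open_Times) auto
  also have "\<dots> \<le> prob (space M - {\<omega>\<in>space M. X 0 \<omega> \<le> t \<and> Y 0 \<omega> \<le> u})"
    by (intro finite_measure_mono) auto
  also have "\<dots> = 1 - F0 (t, u)"
    unfolding F0 by (intro prob_compl) simp
  finally show "F0 (t, u) < 1" by simp
qed



section \<open>From the estimator to a sum of independent local counts\<close>

lemma local_estimator_measurable:
  assumes "n > 0" and [measurable]: "A \<in> sets borel"
  shows "local_estimator X Y T U n A \<in> borel_measurable M"
proof -
  have "local_estimator X Y T U n A = (\<lambda>\<omega>.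
      ((\<Sum>i<n. of_bool (X i \<omega> \<le> T i \<omega>) * of_bool (Y i \<omega> \<le> U i \<omega>) * indicator A (T i \<omega>, U i \<omega>)) / n) /
      ((\<Sum>i<n. indicator A (T i \<omega>, U i \<omega>)) / n))"
    using assms by (intro ext local_estimator_eq)
  also have "\<dots> \<in> borel_measurable M" by measurable
  finally show ?thesis .
qed

text \<open>If no observation point lies in \<open>A\<close>, then \<open>S\<close> vanishes and the quotient takes the junk value 0;
  this is why the first implication needs the strict inequality.\<close>

lemma local_estimator_compare:
  fixes a k q :: real
  assumes "n > 0" and A: "A \<in> sets borel" and "a > 0" "k > 0" and q: "q = \<theta> + x / k"
  defines "S \<equiv> \<lambda>\<omega>. \<Sum>i<n. a * (indicator A (T i \<omega>, U i \<omega>)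
      * (of_bool (X i \<omega> \<le> T i \<omega>) * of_bool (Y i \<omega> \<le> U i \<omega>) - q))"
  shows "S \<omega> < 0 \<Longrightarrow> k * (local_estimator X Y T U n A \<omega> - \<theta>) \<le> x"
    and "k * (local_estimator X Y T U n A \<omega> - \<theta>) \<le> x \<Longrightarrow> S \<omega> \<le> 0"
proof -
  define N C :: real where
    "N = (\<Sum>i<n. of_bool (X i \<omega> \<le> T i \<omega>) * of_bool (Y i \<omega> \<le> U i \<omega>) * indicator A (T i \<omega>, U i \<omega>))"
    and "C = (\<Sum>i<n. indicator A (T i \<omega>, U i \<omega>))"
  have est: "local_estimator X Y T U n A \<omega> = N / C"
    using \<open>n > 0\<close> unfolding local_estimator_eq[OF \<open>n > 0\<close> A] N_def C_def by simp
  have S: "S \<omega> = a * (N - q * C)"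
    by (simp only: S_def N_def C_def sum_distrib_left right_diff_distrib sum_subtractf mult_ac)
  have "0 \<le> N" "N \<le> C"
    unfolding N_def C_def by (intro sum_nonneg sum_mono; simp add: indicator_def)+
  moreover have "k * (N / C - \<theta>) \<le> x \<longleftrightarrow> N \<le> q * C" if "C > 0"
  proof -
    have "k * (N / C - \<theta>) \<le> x \<longleftrightarrow> N / C \<le> q"
      using \<open>k > 0\<close> by (simp add: q field_simps)
    also have "\<dots> \<longleftrightarrow> N \<le> q * C" using that by (simp add: pos_divide_le_eq)
    finally show ?thesis .
  qed
  ultimately have "C = 0 \<and> N = 0 \<or> (k * (N / C - \<theta>) \<le> x \<longleftrightarrow> N \<le> q * C)"
    by linarith
  moreover have "S \<omega> < 0 \<longleftrightarrow> N < q * C" "S \<omega> \<le> 0 \<longleftrightarrow> N \<le> q * C"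
    using \<open>a > 0\<close> by (simp_all add: S mult_less_0_iff mult_le_0_iff)
  ultimately show "S \<omega> < 0 \<Longrightarrow> k * (local_estimator X Y T U n A \<omega> - \<theta>) \<le> x"
    and "k * (local_estimator X Y T U n A \<omega> - \<theta>) \<le> x \<Longrightarrow> S \<omega> \<le> 0"
    unfolding est by auto
qed

text \<open>Both indicators in a summand take the values 0 and 1 only, so its square is again a
  linear combination of them; hence the two integrals \<open>\<phi>\<^sub>0\<close> and
  \<open>\<phi>\<^sub>1\<close> determine first and second moments alike.\<close>

lemma central_limit_theorem_local_counts:
  fixes a q :: "nat \<Rightarrow> real" and A :: "nat \<Rightarrow> (real \<times> real) set" and \<mu> \<sigma> :: real
  defines "\<phi>\<^sub>0 \<equiv> \<lambda>n. LINT z:A n|lborel. g z" and "\<phi>\<^sub>1 \<equiv> \<lambda>n. LINT z:A n|lborel. F0 z * g z"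
  assumes A [measurable]: "\<And>n. A n \<in> sets borel"
    and "(\<lambda>n. \<bar>a n\<bar> * (1 + \<bar>q n\<bar>)) \<longlonglongrightarrow> 0"
    and "(\<lambda>n. n * (a n * (\<phi>\<^sub>1 n - q n * \<phi>\<^sub>0 n))) \<longlonglongrightarrow> \<mu>"
    and "(\<lambda>n. n * ((a n)\<^sup>2 * ((1 - 2 * q n) * \<phi>\<^sub>1 n + (q n)\<^sup>2 * \<phi>\<^sub>0 n))) \<longlonglongrightarrow> \<sigma>\<^sup>2"
    and "\<sigma> > 0"
  shows "weak_conv_m (\<lambda>n. distr M borel (\<lambda>\<omega>. \<Sum>i<n. a n * (indicator (A n) (T i \<omega>, U i \<omega>)
      * (of_bool (X i \<omega> \<le> T i \<omega>) * of_bool (Y i \<omega> \<le> U i \<omega>) - q n)))) (density lborel (normal_density \<mu> \<sigma>))"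
proof -
  let ?I = "\<lambda>n i \<omega>. indicator (A n) (T i \<omega>, U i \<omega>) :: real"
  let ?D = "\<lambda>i \<omega>. of_bool (X i \<omega> \<le> T i \<omega>) * of_bool (Y i \<omega> \<le> U i \<omega>) :: real"
  have int: "integrable M (\<lambda>\<omega>. ?D i \<omega> * ?I n i \<omega>)" "integrable M (?I n i)" for n i
    by (auto intro!: integrable_const_bound[where B = 1])
  show ?thesis
  proof (rule central_limit_theorem_bounded_array)
    show "indep_vars (\<lambda>_. borel) (\<lambda>i \<omega>. a n * (?I n i \<omega> * (?D i \<omega> - q n))) {..<n}" for n
    proof -
      define f :: "(real \<times> real) \<times> real \<times> real \<Rightarrow> real" where
        "f = (\<lambda>(h, z). a n * (indicator (A n) z * (of_bool (fst h \<le> fst z \<and> snd h \<le> snd z) - q n)))"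
      have "(\<lambda>p. indicator (A n) (snd p) :: real) \<in> borel_measurable (borel \<Otimes>\<^sub>M borel)"
        for n by measurable
      then have "f \<in> borel_measurable (borel \<Otimes>\<^sub>M borel)"
        using both_le_measurable unfolding f_def case_prod_unfold by measurable
      from indep_vars_compose2[OF indep_vars_hidden_observation[of "{..<n}"] this]
      show ?thesis by (simp add: f_def of_bool_conj)
    qed
    show "\<bar>a n * (?I n i \<omega> * (?D i \<omega> - q n))\<bar> \<le> \<bar>a n\<bar> * (1 + \<bar>q n\<bar>)" for n i \<omega>
      by (auto simp: abs_mult indicator_def intro!: mult_left_mono)
    have "expectation (\<lambda>\<omega>. a n * (?I n i \<omega> * (?D i \<omega> - q n)))
        = expectation (\<lambda>\<omega>. a n * (?D i \<omega> * ?I n i \<omega> - q n * ?I n i \<omega>))" for n i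
      by (simp add: algebra_simps)
    then show "expectation (\<lambda>\<omega>. a n * (?I n i \<omega> * (?D i \<omega> - q n))) = a n * (\<phi>\<^sub>1 n - q n * \<phi>\<^sub>0 n)" for n i
      using int by (simp add: expectation_observation expectation_hidden_observation \<phi>\<^sub>0_def \<phi>\<^sub>1_def)
    have "expectation (\<lambda>\<omega>. (a n * (?I n i \<omega> * (?D i \<omega> - q n)))\<^sup>2)
        = expectation (\<lambda>\<omega>. (a n)\<^sup>2 * ((1 - 2 * q n) * (?D i \<omega> * ?I n i \<omega>) + (q n)\<^sup>2 * ?I n i \<omega>))" for n i
      by (intro Bochner_Integration.integral_cong) (auto simp: indicator_def power2_eq_square algebra_simps)
    then show "expectation (\<lambda>\<omega>. (a n * (?I n i \<omega> * (?D i \<omega> - q n)))\<^sup>2)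
        = (a n)\<^sup>2 * ((1 - 2 * q n) * \<phi>\<^sub>1 n + (q n)\<^sup>2 * \<phi>\<^sub>0 n)" for n i
      using int by (simp add: expectation_observation expectation_hidden_observation \<phi>\<^sub>0_def \<phi>\<^sub>1_def)
  qed fact+
qed

end

section \<open>Asymptotic normality of the local estimator\<close>

theorem theorem2p1:
  fixes M :: "'a measure"
    and X Y T U :: "nat \<Rightarrow> 'a \<Rightarrow> real"
    and F0 G g :: "real \<times> real \<Rightarrow> real"
    and t u c :: real
    and h :: "nat \<Rightarrow> real"
  assumes "bivariate_current_status M X Y T U F0 G g"
    and "(t, u) \<in> interior ({0..1} \<times> {0..1})"
    and "\<And>n. n \<ge> 1 \<Longrightarrow> h n > 0"
    and "twice_cont_diff_at G (t, u)"
    and "g differentiable at (t, u)"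
    and "g (t, u) > 0"
    and "twice_cont_diff_at F0 (t, u)"
    and "(\<lambda>n. (h n)\<^sup>2 * real n powr (1/3)) \<longlonglongrightarrow> c"
    and "c > 0"
  defines "\<beta> \<equiv> c * (1/6 * (partial1 (partial1 F0) (t, u) + partial2 (partial2 F0) (t, u))
      + (partial1 F0 (t, u) * partial1 g (t, u) + partial2 F0 (t, u) * partial2 g (t, u))
          / (3 * g (t, u)))"
    and "\<sigma>2 \<equiv> F0 (t, u) * (1 - F0 (t, u)) / (4 * c * g (t, u))"
  shows "weak_conv_m
     (\<lambda>n. distr M borel (\<lambda>\<omega>. real n powr (1/3) *
        (local_estimator X Y T U n (square (t, u) (h n)) \<omega> - F0 (t, u))))
     (density lborel (normal_density \<beta> (sqrt \<sigma>2)))"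
proof -
  interpret bivariate_current_status M X Y T U F0 G g by fact
  define p where "p = (t, u)"
  define k where "k n = real n powr (1/3)" for n
  define A where "A n = square p (h n)" for n
  define \<phi>\<^sub>0 where "\<phi>\<^sub>0 n = (LINT z:A n|lborel. g z)" for n
  define \<phi>\<^sub>1 where "\<phi>\<^sub>1 n = (LINT z:A n|lborel. F0 z * g z)" for n
  \<comment> \<open>The denominator approximates the expected number of observation points in the
    square. With this scale the sum imitates \<open>k n\<close> times the error of the estimator,
    minus the level \<open>x\<close>.\<close>
  define a where "a n = k n / (n * (4 * (h n)\<^sup>2 * g p))" for n
  define \<sigma> where "\<sigma> = sqrt \<sigma>2"
  have g: "g p > 0" and c: "c > 0" using assms by (auto simp: p_def)
  have F: "0 < F0 p" "F0 p < 1" using hidden_cdf_interior[OF assms(2)] by (simp_all add: p_def)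
  have \<sigma>2: "\<sigma>2 > 0" using F g c by (simp add: \<sigma>2_def p_def)
  then have \<sigma>: "\<sigma> > 0" "\<sigma>\<^sup>2 = \<sigma>2" by (simp_all add: \<sigma>_def)
  have A [measurable]: "A n \<in> sets borel" for n by (simp add: A_def)
  have k_pos: "k n > 0" and h_pos: "h n > 0" and a_pos: "a n > 0" if "n > 0" for n
    using that g assms(3)[of n] by (auto simp: k_def a_def)
  \<comment> \<open>Writing \<open>n\<close> as a cube turns the comparisons of rates into
    identities between rational functions of \<open>k n\<close> and \<open>h n\<close>.\<close>
  have k_cube: "real n = k n ^ 3" for n
    by (cases "n = 0") (simp_all add: k_def powr_powr flip: powr_realpow)
  have k_lim: "filterlim k at_top sequentially"
    unfolding k_def by real_asymp
  have k_inv: "(\<lambda>n. 1 / k n) \<longlonglongrightarrow> 0"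
    using k_lim by (intro tendsto_divide_0[OF tendsto_const] filterlim_at_top_imp_at_infinity)
  have hk: "(\<lambda>n. (h n)\<^sup>2 * k n) \<longlonglongrightarrow> c" using assms(8) by (simp add: k_def)
  have h_lim: "filterlim h (at_right 0) sequentially"
  proof -
    have "(\<lambda>n. sqrt (((h n)\<^sup>2 * k n) * (1 / k n))) \<longlonglongrightarrow> sqrt (c * 0)"
      by (intro tendsto_intros hk k_inv)
    moreover have "eventually (\<lambda>n. sqrt (((h n)\<^sup>2 * k n) * (1 / k n)) = h n) sequentially"
      using eventually_gt_at_top[of 0] by eventually_elim (simp add: k_pos[THEN less_imp_neq, symmetric] h_pos less_imp_le)
    ultimately have "h \<longlonglongrightarrow> sqrt (c * 0)" by (rule Lim_transform_eventually)
    then show ?thesis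
      by (intro tendsto_imp_filterlim_at_right eventually_mono[OF eventually_gt_at_top[of "0 :: nat"] h_pos]) simp_all
  qed
  have isCont_g: "isCont g p"
    using assms(5) unfolding p_def by (rule differentiable_imp_continuous_within)
  have isCont_F: "isCont F0 p"
    using assms(7) by (simp add: twice_cont_diff_at_def p_def)
  have \<phi>\<^sub>0_lim: "(\<lambda>n. \<phi>\<^sub>0 n / (4 * (h n)\<^sup>2)) \<longlonglongrightarrow> g p"
    unfolding \<phi>\<^sub>0_def A_def
    using filterlim_compose[OF tendsto_average_square[OF integrable_density isCont_g] h_lim] .
  have \<phi>\<^sub>1_lim: "(\<lambda>n. \<phi>\<^sub>1 n / (4 * (h n)\<^sup>2)) \<longlonglongrightarrow> F0 p * g p"
    unfolding \<phi>\<^sub>1_def A_def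
    using filterlim_compose[OF tendsto_average_square[OF integrable_hidden_cdf_density isCont_mult[OF isCont_F isCont_g]] h_lim] .
  \<comment> \<open>One third of the sum of the two pure square coefficients in
    \<open>expansion_weighted_increment\<close>.\<close>
  define \<kappa> where "\<kappa> = ((g p * (partial1 (partial1 F0) p / 2) + partial1 F0 p * partial1 g p)
    + (g p * (partial2 (partial2 F0) p / 2) + partial2 F0 p * partial2 g p)) / 3"
  have bias: "(\<lambda>n. (\<phi>\<^sub>1 n - F0 p * \<phi>\<^sub>0 n) / (4 * h n ^ 4)) \<longlonglongrightarrow> \<kappa>"
  proof -
    have "integrable lborel (\<lambda>z. (F0 z - F0 p) * g z)"
      using integrable_hidden_cdf_density integrable_density by (simp add: left_diff_distrib)
    from tendsto_set_integral_square_second_order[OF this expansion_weighted_increment[OF assms(7,5), folded p_def]]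
    have "((\<lambda>r. (LINT z:square p r|lborel. (F0 z - F0 p) * g z) / (4 * r ^ 4)) \<longlongrightarrow> \<kappa>) (at_right 0)"
      by (simp add: \<kappa>_def)
    from filterlim_compose[OF this h_lim]
    have "(\<lambda>n. (LINT z:A n|lborel. (F0 z - F0 p) * g z) / (4 * h n ^ 4)) \<longlonglongrightarrow> \<kappa>"
      by (simp add: A_def)
    moreover have "(LINT z:A n|lborel. (F0 z - F0 p) * g z) = \<phi>\<^sub>1 n - F0 p * \<phi>\<^sub>0 n" for n
    proof -
      have "set_integrable lborel (A n) g" "set_integrable lborel (A n) (\<lambda>z. F0 z * g z)"
        unfolding set_integrable_def
        by (intro integrable_mult_indicator integrable_density integrable_hidden_cdf_density; simp)+
      then show ?thesis by (simp add: left_diff_distrib \<phi>\<^sub>0_def \<phi>\<^sub>1_def)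
    qed
    ultimately show ?thesis by simp
  qed
  have \<beta>: "\<beta> = c * \<kappa> / g p"
    using g by (simp add: \<beta>_def \<kappa>_def p_def field_simps)
  define q where "q x n = F0 p + x / k n" for x n
  define S where "S x n \<omega> = (\<Sum>i<n. a n * (indicator (A n) (T i \<omega>, U i \<omega>)
      * (of_bool (X i \<omega> \<le> T i \<omega>) * of_bool (Y i \<omega> \<le> U i \<omega>) - q x n)))" for x n \<omega>
  have S_measurable [measurable]: "S x n \<in> borel_measurable M" for x n
    unfolding S_def[abs_def] by measurable
  have clt: "weak_conv_m (\<lambda>n. distr M borel (S x n)) (density lborel (normal_density (\<beta> - x) \<sigma>))" for x
  proof -
    have q: "q x \<longlonglongrightarrow> F0 p"
      using tendsto_add[OF tendsto_const tendsto_mult[OF tendsto_const[of x] k_inv], of "F0 p"]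
      by (simp add: q_def[abs_def])
    have "(\<lambda>n. \<bar>a n\<bar> * (1 + \<bar>q x n\<bar>)) \<longlonglongrightarrow> 0"
    proof -
      \<comment> \<open>This is \<open>\<bar>a n\<bar>\<close> after replacing \<open>n\<close> by
        \<open>k n ^ 3\<close>; as \<open>(h n)\<^sup>2 * k n\<close> has a positive limit, single
        summands are of order \<open>1 / k n\<close>.\<close>
      have "(\<lambda>n. \<bar>1 / (4 * g p) * (1 / k n) / ((h n)\<^sup>2 * k n)\<bar>) \<longlonglongrightarrow> \<bar>1 / (4 * g p) * 0 / c\<bar>"
        using c by (intro tendsto_intros k_inv hk) auto
      moreover have "eventually (\<lambda>n. \<bar>1 / (4 * g p) * (1 / k n) / ((h n)\<^sup>2 * k n)\<bar> = \<bar>a n\<bar>) sequentially"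
        using eventually_gt_at_top[of 0]
      proof eventually_elim
        case (elim n)
        then show ?case
          using k_pos[of n] h_pos[of n] g unfolding a_def k_cube[of n]
          by (simp add: field_simps power_numeral_reduce)
      qed
      ultimately have "(\<lambda>n. \<bar>a n\<bar>) \<longlonglongrightarrow> \<bar>1 / (4 * g p) * 0 / c\<bar>" by (rule Lim_transform_eventually)
      from tendsto_mult[OF this tendsto_add[OF tendsto_const tendsto_rabs[OF q]], of 1] show ?thesis by simp
    qed
    moreover have "(\<lambda>n. n * (a n * (\<phi>\<^sub>1 n - q x n * \<phi>\<^sub>0 n))) \<longlonglongrightarrow> \<beta> - x"
    proof -
      \<comment> \<open>The mean splits along \<open>q x n = F0 p + x / k n\<close>: the part with
        \<open>F0 p\<close> is the bias and tends to \<beta>, the part with \<open>x / k n\<close>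
        tends to \<open>x\<close> because \<open>k n\<close> cancels.\<close>
      have "(\<lambda>n. ((h n)\<^sup>2 * k n) * ((\<phi>\<^sub>1 n - F0 p * \<phi>\<^sub>0 n) / (4 * h n ^ 4)) / g p
          - x * (\<phi>\<^sub>0 n / (4 * (h n)\<^sup>2)) / g p) \<longlonglongrightarrow> c * \<kappa> / g p - x * g p / g p"
        using g by (intro tendsto_intros hk bias \<phi>\<^sub>0_lim) auto
      also have "c * \<kappa> / g p - x * g p / g p = \<beta> - x"
        using g by (simp add: \<beta>)
      finally show ?thesis
      proof (rule Lim_transform_eventually)
        show "eventually (\<lambda>n. ((h n)\<^sup>2 * k n) * ((\<phi>\<^sub>1 n - F0 p * \<phi>\<^sub>0 n) / (4 * h n ^ 4)) / g p
            - x * (\<phi>\<^sub>0 n / (4 * (h n)\<^sup>2)) / g p = n * (a n * (\<phi>\<^sub>1 n - q x n * \<phi>\<^sub>0 n))) sequentially"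
          using eventually_gt_at_top[of 0]
        proof eventually_elim
          case (elim n)
          have eq: "n * (a n * (\<phi>\<^sub>1 n - q x n * \<phi>\<^sub>0 n)) = k n / (4 * (h n)\<^sup>2 * g p) * (\<phi>\<^sub>1 n - q x n * \<phi>\<^sub>0 n)"
            using elim by (simp add: a_def)
          show ?case
            unfolding eq using k_pos[OF elim] h_pos[OF elim] g
            by (simp add: q_def field_simps power_numeral_reduce)
        qed
      qed
    qed
    moreover have "(\<lambda>n. n * ((a n)\<^sup>2 * ((1 - 2 * q x n) * \<phi>\<^sub>1 n + (q x n)\<^sup>2 * \<phi>\<^sub>0 n))) \<longlonglongrightarrow> \<sigma>\<^sup>2"
    proof -
      \<comment> \<open>Here \<open>n * (a n)\<^sup>2\<close> has been rewritten so that one factor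
        \<open>4 * (h n)\<^sup>2\<close> normalises the integrals and the rest tends to
        \<open>4 * c * (g p)\<^sup>2\<close>. In the limit
        \<open>(1 - 2 * F0 p) * F0 p + (F0 p)\<^sup>2\<close> is the Bernoulli variance.\<close>
      have "(\<lambda>n. ((1 - 2 * q x n) * (\<phi>\<^sub>1 n / (4 * (h n)\<^sup>2)) + (q x n)\<^sup>2 * (\<phi>\<^sub>0 n / (4 * (h n)\<^sup>2)))
          / (4 * ((h n)\<^sup>2 * k n) * (g p)\<^sup>2))
        \<longlonglongrightarrow> ((1 - 2 * F0 p) * (F0 p * g p) + (F0 p)\<^sup>2 * g p) / (4 * c * (g p)\<^sup>2)"
        using g c by (intro tendsto_intros hk \<phi>\<^sub>0_lim \<phi>\<^sub>1_lim q) auto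
      also have "((1 - 2 * F0 p) * (F0 p * g p) + (F0 p)\<^sup>2 * g p) / (4 * c * (g p)\<^sup>2) = \<sigma>\<^sup>2"
        using g c unfolding \<sigma>(2) \<sigma>2_def p_def[symmetric] by (simp add: field_simps power2_eq_square)
      finally show ?thesis
      proof (rule Lim_transform_eventually)
        show "eventually (\<lambda>n. ((1 - 2 * q x n) * (\<phi>\<^sub>1 n / (4 * (h n)\<^sup>2)) + (q x n)\<^sup>2 * (\<phi>\<^sub>0 n / (4 * (h n)\<^sup>2)))
          / (4 * ((h n)\<^sup>2 * k n) * (g p)\<^sup>2)
          = n * ((a n)\<^sup>2 * ((1 - 2 * q x n) * \<phi>\<^sub>1 n + (q x n)\<^sup>2 * \<phi>\<^sub>0 n))) sequentially"
          using eventually_gt_at_top[of 0]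
        proof eventually_elim
          case (elim n)
          have "n * (a n)\<^sup>2 = 1 / (4 * (h n)\<^sup>2) / (4 * ((h n)\<^sup>2 * k n) * (g p)\<^sup>2)"
            using k_pos[OF elim] h_pos[OF elim] g unfolding a_def k_cube[of n]
            by (simp add: field_simps power_numeral_reduce)
          then show ?case by (simp add: mult.assoc[symmetric] add_divide_distrib)
        qed
      qed
    qed
    ultimately show ?thesis
      unfolding S_def[abs_def] \<phi>\<^sub>0_def \<phi>\<^sub>1_def
      by (intro central_limit_theorem_local_counts A \<sigma>(1))
  qed
  define \<Phi> where "\<Phi> = cdf (density lborel (normal_density \<beta> \<sigma>))"
  \<comment> \<open>Used at \<open>y = 0\<close> for the upper bound and at
    \<open>y = - \<epsilon>\<close> for the lower one, since a sum that is at most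
    \<open>- \<epsilon>\<close> is strictly negative.\<close>
  have cdf_S: "(\<lambda>n. cdf (distr M borel (S x n)) y) \<longlonglongrightarrow> \<Phi> (x + y)" for x y
    using clt[of x] isCont_cdf_normal[OF \<sigma>(1)]
    by (simp add: weak_conv_m_def weak_conv_def cdf_normal_shift[OF \<sigma>(1)] \<Phi>_def add.commute[of x y])
  have "(\<lambda>n. cdf (distr M borel (\<lambda>\<omega>. k n * (local_estimator X Y T U n (A n) \<omega> - F0 p))) x) \<longlonglongrightarrow> \<Phi> x" for x
  proof (rule isCont_sandwich_tendsto[where \<Phi> = \<Phi> and x = x])
    show "isCont \<Phi> x" unfolding \<Phi>_def using \<sigma>(1) by (rule isCont_cdf_normal)
    show "(\<lambda>n. cdf (distr M borel (S x n)) (- \<epsilon>)) \<longlonglongrightarrow> \<Phi> (x - \<epsilon>)" for \<epsilon>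
      using cdf_S[of x "- \<epsilon>"] by simp
    show "(\<lambda>n. cdf (distr M borel (S x n)) 0) \<longlonglongrightarrow> \<Phi> x"
      using cdf_S[of x 0] by simp
    fix \<epsilon> :: real assume "\<epsilon> > 0"
    show "eventually (\<lambda>n. cdf (distr M borel (S x n)) (- \<epsilon>)
          \<le> cdf (distr M borel (\<lambda>\<omega>. k n * (local_estimator X Y T U n (A n) \<omega> - F0 p))) x \<and>
        cdf (distr M borel (\<lambda>\<omega>. k n * (local_estimator X Y T U n (A n) \<omega> - F0 p))) x
          \<le> cdf (distr M borel (S x n)) 0) sequentially"
      using eventually_gt_at_top[of 0]
    proof eventually_elim
      case (elim n)
      have [measurable]: "local_estimator X Y T U n (A n) \<in> borel_measurable M"
        using elim A by (rule local_estimator_measurable)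
      note compare = local_estimator_compare[OF elim A[of n] a_pos[OF elim] k_pos[OF elim] q_def, folded S_def]
      have "cdf (distr M borel W) y = prob {\<omega>\<in>space M. W \<omega> \<le> y}" if "W \<in> borel_measurable M" for W y
        unfolding cdf_def using that by (subst measure_distr) (auto intro!: arg_cong[where f = prob])
      then show ?case
        using compare \<open>\<epsilon> > 0\<close> by (auto intro!: finite_measure_mono)
    qed
  qed
  then show ?thesis
    by (simp add: weak_conv_m_def weak_conv_def \<Phi>_def \<sigma>_def k_def A_def p_def)
qed

end
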